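(* There is an algorithm which, given a 2-XOR-CNF formula $\varphi$, generates all maximal signatures of $\varphi$ with polynomial delay; likewise there is a polynomial-delay algorithm generating all minimal signatures of a 2-XOR-CNF.
   Context: An XOR-clause over Boolean variables $V$ is a linear equation $x_{i_1} + \dots + x_{i_k} = \varepsilon$ over $\mathrm{GF}(2)$, $\varepsilon\in\{0,1\}$; a 2-XOR-CNF is a conjunction $\varphi = C_1\land\dots\land C_m$ of XOR-clauses each involving at most two variables (i.e. clauses of the forms $x=y$, $x\neq y$, $x=1$, $x=0$). For an assignment $a\colon V\to\{0,1\}$, $C_i(a)=1$ if $C_i$ holds under $a$ and $0$ otherwise; the signature produced by $a$ is $(C_1(a),\dots,C_m(a))\in\{0,1\}^m$, and the signatures of $\varphi$ are all sequences so produced. Sequences are ordered bitwise ($\sigma\le\tau$ iff $\sigma[i]\le\tau[i]$ for all $i$); minimal/maximal signatures are minimal/maximal elements for $\le$ among signatures of $\varphi$. Polynomial delay: the time before the first output, between consecutive outputs, and after the last output is polynomial in the input size. *)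

theory Defs
  imports
    "HOL-Library.Z2"
    "HOL-Library.Log_Nat"
    "HOL-Computational_Algebra.Polynomial"
begin

section \<open>XOR formulas and their signatures\<close>

text \<open>
  The pair \<^term>\<open>([x\<^sub>1, x\<^sub>2], e) :: nat list \<times> bit\<close> is the equation \<open>x\<^sub>1 + x\<^sub>2 = e\<close> over
  \<open>GF(2)\<close>, with variables named by natural numbers. Assignments are total on \<^typ>\<open>nat\<close>;
  only the values at variables that occur in the formula matter.
\<close>

type_synonym xor_clause = "nat list \<times> bit"

type_synonym xor_cnf = "xor_clause list"

definition holds :: "(nat \<Rightarrow> bit) \<Rightarrow> xor_clause \<Rightarrow> bool" where
  "holds a C \<longleftrightarrow> sum_list (map a (fst C)) = snd C"

definition two_xor_cnf :: "xor_cnf \<Rightarrow> bool" where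
  "two_xor_cnf \<phi> \<longleftrightarrow> (\<forall>C\<in>set \<phi>. length (fst C) \<le> 2)"

definition signature :: "xor_cnf \<Rightarrow> (nat \<Rightarrow> bit) \<Rightarrow> nat list" where
  "signature \<phi> a = map (\<lambda>C. of_bool (holds a C)) \<phi>"

definition signatures :: "xor_cnf \<Rightarrow> nat list set" where
  "signatures \<phi> = range (signature \<phi>)"

definition bitwise_le :: "nat list \<Rightarrow> nat list \<Rightarrow> bool" where
  "bitwise_le = list_all2 (\<le>)"

definition maximal_signatures :: "xor_cnf \<Rightarrow> nat list set" where
  "maximal_signatures \<phi> =
     {\<sigma> \<in> signatures \<phi>. \<forall>\<tau>\<in>signatures \<phi>. bitwise_le \<sigma> \<tau> \<longrightarrow> \<tau> = \<sigma>}"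

definition minimal_signatures :: "xor_cnf \<Rightarrow> nat list set" where
  "minimal_signatures \<phi> =
     {\<sigma> \<in> signatures \<phi>. \<forall>\<tau>\<in>signatures \<phi>. bitwise_le \<tau> \<sigma> \<longrightarrow> \<tau> = \<sigma>}"

section \<open>Random access machines with logarithmic cost\<close>

text \<open>
  The machine has registers, a random access memory, and a write-only output buffer. Instructions
  are charged the binary length of the numbers and addresses they handle. Unit cost would not be
  adequate for polynomial delay: an enumeration may run for exponentially many steps, and repeated
  addition could then produce numbers of exponential length that are handled in a single step.
  Control flow is structured instead of being given by jumps.

  \<open>Emit\<close> outputs the contents of the buffer as one solution and clears the buffer; \<open>outs\<close> records
  all solutions output so far, each with the time of its output.
\<close>

record state =
  regs :: "nat \<Rightarrow> nat"
  mem :: "nat \<Rightarrow> nat"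
  buf :: "nat list"
  clock :: nat
  outs :: "(nat \<times> nat list) list"

datatype instr =
    Nop
  | Const nat nat
  | Move nat nat
  | Add nat nat nat
  | Sub nat nat nat
  | Load nat nat
  | Store nat nat
  | Write nat
  | Emit

datatype com =
    Do instr
  | Seq com com
  | Cond nat com com
  | While nat com

definition word_size :: "nat \<Rightarrow> nat" where
  "word_size n = max 1 (floorlog 2 n)"

definition tick :: "nat \<Rightarrow> state \<Rightarrow> state" where
  "tick k s = s\<lparr>clock := clock s + k\<rparr>"

fun cost :: "instr \<Rightarrow> state \<Rightarrow> nat" where
  "cost Nop s = 1"
| "cost (Const i n) s = word_size n"
| "cost (Move i j) s = word_size (regs s j)"
| "cost (Add i j k) s = word_size (regs s j) + word_size (regs s k)"
| "cost (Sub i j k) s = word_size (regs s j) + word_size (regs s k)"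
| "cost (Load i j) s = word_size (regs s j) + word_size (mem s (regs s j))"
| "cost (Store i j) s = word_size (regs s i) + word_size (regs s j)"
| "cost (Write i) s = word_size (regs s i)"
| "cost Emit s = 1"

fun effect :: "instr \<Rightarrow> state \<Rightarrow> state" where
  "effect Nop s = s"
| "effect (Const i n) s = s\<lparr>regs := (regs s)(i := n)\<rparr>"
| "effect (Move i j) s = s\<lparr>regs := (regs s)(i := regs s j)\<rparr>"
| "effect (Add i j k) s = s\<lparr>regs := (regs s)(i := regs s j + regs s k)\<rparr>"
| "effect (Sub i j k) s = s\<lparr>regs := (regs s)(i := regs s j - regs s k)\<rparr>"
| "effect (Load i j) s = s\<lparr>regs := (regs s)(i := mem s (regs s j))\<rparr>"
| "effect (Store i j) s = s\<lparr>mem := (mem s)(regs s i := regs s j)\<rparr>"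
| "effect (Write i) s = s\<lparr>buf := buf s @ [regs s i]\<rparr>"
| "effect Emit s = s\<lparr>outs := outs s @ [(clock s, buf s)], buf := []\<rparr>"

text \<open>A register that is tested counts as true if it is nonzero.\<close>

inductive exec :: "com \<Rightarrow> state \<Rightarrow> state \<Rightarrow> bool" where
  Do: "exec (Do i) s (effect i (tick (cost i s) s))"
| Seq: "exec c s s' \<Longrightarrow> exec d s' s'' \<Longrightarrow> exec (Seq c d) s s''"
| CondTrue: "regs s r \<noteq> 0 \<Longrightarrow> exec c (tick (word_size (regs s r)) s) s'
    \<Longrightarrow> exec (Cond r c d) s s'"
| CondFalse: "regs s r = 0 \<Longrightarrow> exec d (tick (word_size (regs s r)) s) s'
    \<Longrightarrow> exec (Cond r c d) s s'"
| WhileFalse: "regs s r = 0 \<Longrightarrow> exec (While r c) s (tick (word_size (regs s r)) s)"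
| WhileTrue: "regs s r \<noteq> 0 \<Longrightarrow> exec c (tick (word_size (regs s r)) s) s'
    \<Longrightarrow> exec (While r c) s' s'' \<Longrightarrow> exec (While r c) s s''"

inductive_cases exec_DoE: "exec (Do i) s t"
inductive_cases exec_SeqE: "exec (Seq c d) s t"
inductive_cases exec_CondE: "exec (Cond r c d) s t"
inductive_cases exec_WhileE: "exec (While r c) s t"

lemma exec_deterministic: "exec c s t \<Longrightarrow> exec c s u \<Longrightarrow> u = t"
proof (induction arbitrary: u rule: exec.induct)
  case (Do i s)
  then show ?case by (auto elim: exec_DoE)
next
  case (Seq c s s' d s'')
  from Seq.prems show ?case by (rule exec_SeqE) (metis Seq.IH)
next
  case (CondTrue s r c s' d)
  from CondTrue.prems show ?case by (rule exec_CondE) (metis CondTrue.IH, metis CondTrue.hyps(1))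
next
  case (CondFalse s r d s' c)
  from CondFalse.prems show ?case by (rule exec_CondE)
    (metis CondFalse.hyps(1) less_irrefl, metis CondFalse.IH CondFalse.hyps(1))
next
  case (WhileFalse s r c)
  from WhileFalse.prems show ?case by (rule exec_WhileE)
    (metis WhileFalse.hyps, metis WhileFalse.hyps less_irrefl)
next
  case (WhileTrue s r c s' s'')
  from WhileTrue.prems show ?case by (rule exec_WhileE) (metis WhileTrue.hyps(1), metis WhileTrue.IH)
qed

section \<open>Enumeration with polynomial delay\<close>

definition initial_state :: "nat list \<Rightarrow> state" where
  "initial_state ws =
     \<lparr>regs = (\<lambda>_. 0), mem = (\<lambda>i. if i < length ws then ws ! i else 0),
      buf = [], clock = 0, outs = []\<rparr>"

definition input_size :: "nat list \<Rightarrow> nat" where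
  "input_size ws = sum_list (map word_size ws)"

text \<open>
  The list of times below consists of the start, all output times, and the halting time, so
  the bound covers the time before the first output, between consecutive outputs, and after the
  last output.
\<close>

definition delay_at_most :: "nat \<Rightarrow> state \<Rightarrow> bool" where
  "delay_at_most d s \<longleftrightarrow>
     successively (\<lambda>t u. u \<le> t + d) (0 # map fst (outs s) @ [clock s])"

definition enumerates_with_poly_delay ::
    "com \<Rightarrow> 'a set \<Rightarrow> ('a \<Rightarrow> nat list) \<Rightarrow> ('a \<Rightarrow> nat list set) \<Rightarrow> bool" where
  "enumerates_with_poly_delay c X enc sols \<longleftrightarrow>
     (\<exists>p :: nat poly. \<forall>x\<in>X. \<exists>s.
        exec c (initial_state (enc x)) s \<and>
        distinct (map snd (outs s)) \<and>
        set (map snd (outs s)) = sols x \<and>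
        delay_at_most (poly p (input_size (enc x))) s)"

text \<open>
  Input format: the number of clauses, followed for each clause by its number of variables, these
  variables, and its right-hand side.
\<close>

definition encode_clause :: "xor_clause \<Rightarrow> nat list" where
  "encode_clause C = length (fst C) # fst C @ [of_bool (snd C = 1)]"

definition encode_cnf :: "xor_cnf \<Rightarrow> nat list" where
  "encode_cnf \<phi> = length \<phi> # concat (map encode_clause \<phi>)"

end

theory Submission
  imports Defs
begin

text \<open>
  A clause \<open>x + y = \<epsilon>\<close> is an edge of a graph on the variables and one more vertex for the constant
  \<open>0\<close>, and an assignment is maximal iff the edges it satisfies connect every component of this graph.
  Starting from any assignment, a maximal one that satisfies at least the same clauses is found by
  merging the components of satisfied edges along the remaining clauses, flipping one side if necessary.

  Given two maximal assignments \<open>a\<close> and \<open>b\<close> with different signatures, consider the vertices connected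
  to a root of their component by edges that both satisfy. Some edge satisfied by \<open>b\<close> leaves this set.
  Flipping \<open>a\<close> at its outer endpoint and completing again enlarges the set. Hence all maximal
  signatures are reachable from any one of them by flips of a single vertex followed by completion,
  and a breadth-first search with one output per dequeued signature has polynomial delay. The table of
  visited signatures is addressed directly by the signatures read as binary numbers, whose length is
  linear in the number of clauses.

  Negating all right-hand sides complements the signatures, which covers the minimal ones.
\<close>

section \<open>Maximal assignments of a clause graph\<close>

text \<open>Cost is logarithmic and the search may take exponentially many steps, so its correctness
  does not settle the delay: words must not grow with the number of iterations. Within one iteration
  every step lengthens words by at most one bit, which a polynomial absorbs. Across iterations the
  growth is cut off by an invariant at the head of the main loop: all working registers except the
  queue pointers are zero, the pointers are at most \<open>m + 1\<close> times the number of
  solutions, and array cells hold only bits and vertex numbers, because codes of signatures serve as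
  addresses and are never stored. The queue holds signatures instead of assignments. The flipped
  bits are again the truth vector of some assignment, and the completion rebuilds a suitable
  assignment from such a vector alone.\<close>

locale clause_graph =
  fixes m :: nat and U V :: "nat \<Rightarrow> nat" and E :: "nat \<Rightarrow> bool"
begin

text \<open>Over GF(2) this is \<open>a (U j) + a (V j) = E j\<close>. Only differences of values
  enter, so complementing \<open>a\<close> everywhere changes no clause, and the vertex for the
  constant 0 may take either value.\<close>

definition sat :: "(nat \<Rightarrow> bool) \<Rightarrow> nat \<Rightarrow> bool" where
  "sat a j \<longleftrightarrow> (a (U j) \<noteq> a (V j)) = E j"

definition sig :: "(nat \<Rightarrow> bool) \<Rightarrow> bool list" where
  "sig a = map (sat a) [0..<m]"

definition maximal :: "(nat \<Rightarrow> bool) \<Rightarrow> bool" where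
  "maximal a \<longleftrightarrow> (\<forall>b. (\<forall>j<m. sat a j \<longrightarrow> sat b j) \<longrightarrow> (\<forall>j<m. sat b j \<longrightarrow> sat a j))"

definition sols :: "bool list set" where
  "sols = sig ` Collect maximal"

definition verts :: "nat set" where
  "verts = U ` {..<m} \<union> V ` {..<m}"

lemma length_sig [simp]: "length (sig a) = m"
  by (simp add: sig_def)

lemma nth_sig [simp]: "j < m \<Longrightarrow> sig a ! j = sat a j"
  by (simp add: sig_def)

lemma finite_verts [simp]: "finite verts"
  by (simp add: verts_def)

lemma length_sols: "\<sigma> \<in> sols \<Longrightarrow> length \<sigma> = m"
  by (auto simp: sols_def)

lemma finite_sols: "finite sols"
  by (rule finite_subset[of _ "{xs. set xs \<subseteq> UNIV \<and> length xs = m}"])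
    (use length_sols in auto, rule finite_lists_length_eq[where A = UNIV, simplified], simp)

text \<open>Crude, but sufficient: positions in a queue of distinct solutions need only linearly
  many bits.\<close>

lemma card_sols: "card sols \<le> 2 ^ m"
proof -
  have "card sols \<le> card {xs :: bool list. set xs \<subseteq> UNIV \<and> length xs = m}"
    by (rule card_mono) (use length_sols in auto, rule finite_lists_length_eq[where A = UNIV, simplified], simp)
  also have "\<dots> = 2 ^ m"
    by (subst card_lists_length_eq) auto
  finally show ?thesis .
qed

subsection \<open>Greedy completion\<close>

text \<open>
  A pair \<open>(l, a)\<close> consists of component labels and an assignment; only the values of \<open>a\<close> relative
  to each other inside a component are meaningful. Merging along a clause flips one of the two
  components if the clause is violated.
\<close>

definition merge :: "nat \<Rightarrow> (nat \<Rightarrow> nat) \<times> (nat \<Rightarrow> bool) \<Rightarrow> (nat \<Rightarrow> nat) \<times> (nat \<Rightarrow> bool)" where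
  "merge j p = (let (l, a) = p in
     if l (U j) = l (V j) then p
     else (\<lambda>w. if l w = l (U j) then l (V j) else l w,
           \<lambda>w. if l w = l (U j) then a w \<noteq> (\<not> sat a j) else a w))"

text \<open>The first pass makes the flagged clauses hold if they are jointly satisfiable; the
  second joins whatever is left, for maximality. The start has singleton components, so its values
  are arbitrary.\<close>

definition merge_all :: "(nat \<Rightarrow> bool) \<Rightarrow> (nat \<Rightarrow> nat) \<times> (nat \<Rightarrow> bool)" where
  "merge_all F = fold merge [0..<m] (fold merge (filter F [0..<m]) (\<lambda>w. w, \<lambda>_. False))"

definition completion :: "(nat \<Rightarrow> bool) \<Rightarrow> bool list" where
  "completion F = sig (snd (merge_all F))"

definition joined :: "(nat \<Rightarrow> nat) \<times> (nat \<Rightarrow> bool) \<Rightarrow> nat \<Rightarrow> bool" where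
  "joined p j \<longleftrightarrow> fst p (U j) = fst p (V j)"

text \<open>On every component \<open>b\<close> is the current assignment or its complement;
  comparing relative values avoids saying which.\<close>

definition agrees :: "(nat \<Rightarrow> bool) \<Rightarrow> (nat \<Rightarrow> nat) \<times> (nat \<Rightarrow> bool) \<Rightarrow> bool" where
  "agrees b p \<longleftrightarrow>
     (\<forall>w w'. fst p w = fst p w' \<longrightarrow> (snd p w \<noteq> snd p w') = (b w \<noteq> b w'))"

text \<open>Vertices with a common label are flipped together or not at all. Hence a clause inside a
  component keeps its truth value from then on.\<close>

lemma merge_same_label:
  assumes "fst p w = fst p w'"
  shows "fst (merge j p) w = fst (merge j p) w'"
    and "(snd (merge j p) w \<noteq> snd (merge j p) w') = (snd p w \<noteq> snd p w')"
proof -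
  obtain l a where p: "p = (l, a)" by fastforce
  with assms have "l w = l w'" by simp
  then show "fst (merge j p) w = fst (merge j p) w'"
    by (simp add: merge_def p)
  show "(snd (merge j p) w \<noteq> snd (merge j p) w') = (snd p w \<noteq> snd p w')"
    using \<open>l w = l w'\<close>
    by (cases "l (U j) = l (V j)"; cases "l w = l (U j)"; cases "sat a j") (simp_all add: merge_def p)
qed

lemma merge_joins: "joined (merge j p) j"
  by (auto simp: merge_def joined_def Let_def split: prod.splits)

lemma merge_sat_new: "\<not> joined p j \<Longrightarrow> sat (snd (merge j p)) j"
  by (auto simp: merge_def joined_def sat_def Let_def split: prod.splits)

lemma joined_merge: "joined p i \<Longrightarrow> joined (merge j p) i"
  unfolding joined_def by (rule merge_same_label(1))

lemma sat_merge: "joined p i \<Longrightarrow> sat (snd (merge j p)) i = sat (snd p) i"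
  unfolding joined_def sat_def using merge_same_label(2)[of p "U i" "V i" j] by simp

lemma agrees_sat: "agrees b p \<Longrightarrow> joined p j \<Longrightarrow> sat (snd p) j = sat b j"
  unfolding agrees_def joined_def sat_def by metis

text \<open>Before a proper merge, \<open>b\<close> is determined up to complement on each of the
  two components. Afterwards clause \<open>j\<close> holds under both assignments, and this fixes
  one complement relative to the other.\<close>

lemma agrees_merge:
  assumes "agrees b p" "sat b j"
  shows "agrees b (merge j p)"
proof -
  obtain l a where p: "p = (l, a)" by fastforce
  have *: "l w = l w' \<Longrightarrow> (a w \<noteq> a w') = (b w \<noteq> b w')" for w w'
    using assms(1) by (simp add: agrees_def p)
  have cross: "(a w \<noteq> (\<not> sat a j)) \<noteq> a w' \<longleftrightarrow> b w \<noteq> b w'"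
    if "l w = l (U j)" "l w' = l (V j)" for w w'
    using *[OF that(1)] *[OF that(2)] assms(2) by (auto simp: sat_def)
  show ?thesis
    unfolding agrees_def
  proof (intro allI impI)
    fix w w' assume eq: "fst (merge j p) w = fst (merge j p) w'"
    show "(snd (merge j p) w \<noteq> snd (merge j p) w') = (b w \<noteq> b w')"
    proof (cases "l w = l w'")
      case True
      then show ?thesis using merge_same_label(2)[of p w w' j] * by (simp add: p)
    next
      case False
      then consider "l (U j) \<noteq> l (V j)" "l w = l (U j)" "l w' = l (V j)"
        | "l (U j) \<noteq> l (V j)" "l w' = l (U j)" "l w = l (V j)"
        using eq by (auto simp: merge_def p split: if_splits)
      then show ?thesis
        by cases (use cross[of w w'] cross[of w' w] in \<open>auto simp: merge_def p\<close>)
    qed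
  qed
qed

lemma fold_merge_mono:
  assumes "joined p i"
  shows "joined (fold merge js p) i \<and> sat (snd (fold merge js p)) i = sat (snd p) i"
  using assms
proof (induction js arbitrary: p)
  case (Cons j js)
  then show ?case using Cons.IH[OF joined_merge[of p i j]] sat_merge[of p i j] by simp
qed simp

lemma fold_merge_joins: "j \<in> set js \<Longrightarrow> joined (fold merge js p) j"
proof (induction js arbitrary: p)
  case (Cons i js)
  then show ?case using fold_merge_mono[OF merge_joins] by fastforce
qed simp

lemma agrees_fold_merge:
  "agrees b p \<Longrightarrow> \<forall>j\<in>set js. sat b j \<Longrightarrow> agrees b (fold merge js p)"
  by (induction js arbitrary: p) (simp_all add: agrees_merge)

lemma agrees_init: "agrees b (\<lambda>w. w, a)"
  by (simp add: agrees_def)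

lemma joined_merge_all: "j < m \<Longrightarrow> joined (merge_all F) j"
  unfolding merge_all_def by (rule fold_merge_joins) simp

text \<open>Since \<open>F\<close> is the truth vector of an actual assignment \<open>b\<close>, the
  first pass only uses clauses true under \<open>b\<close> and keeps agreement with
  \<open>b\<close>. The flagged clauses are then joined and true, and the second pass cannot alter
  joined clauses.\<close>

lemma completion_extends:
  assumes "\<And>j. j < m \<Longrightarrow> F j = sat b j" "j < m" "F j"
  shows "sat (snd (merge_all F)) j"
proof -
  let ?p = "fold merge (filter F [0..<m]) (\<lambda>w. w, \<lambda>_. False)"
  have ag: "agrees b ?p"
    by (rule agrees_fold_merge[OF agrees_init]) (use assms(1) in auto)
  have jo: "joined ?p j"
    by (rule fold_merge_joins) (use assms in auto)
  show ?thesis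
    using fold_merge_mono[OF jo, of "[0..<m]"] agrees_sat[OF ag jo] assms by (simp add: merge_all_def)
qed

text \<open>
  Whatever satisfies the clauses already joined agrees with the current assignment on every
  component: this is why the result of the completion is maximal.
\<close>

lemma merge_all_forced:
  assumes "\<forall>j<m. sat (snd (merge_all F)) j \<longrightarrow> sat b j"
  shows "agrees b (merge_all F)"
proof -
  \<comment> \<open>The premise is restricted to joined clauses because only their truth values are
    final. It therefore passes from the merged pair back to the earlier one, and the implication is
    preserved by every merge.\<close>
  define forced where
    "forced p \<longleftrightarrow> ((\<forall>j<m. joined p j \<and> sat (snd p) j \<longrightarrow> sat b j) \<longrightarrow> agrees b p)" for p
  have step: "forced (merge j p)" if "forced p" "j < m" for j p
    unfolding forced_def
  proof
    assume prem: "\<forall>i<m. joined (merge j p) i \<and> sat (snd (merge j p)) i \<longrightarrow> sat b i"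
    then have "\<forall>i<m. joined p i \<and> sat (snd p) i \<longrightarrow> sat b i"
      using joined_merge sat_merge by blast
    with that(1) have ag: "agrees b p" by (simp add: forced_def)
    show "agrees b (merge j p)"
    proof (cases "joined p j")
      case True
      then have "merge j p = p" by (auto simp: merge_def joined_def split: prod.splits)
      with ag show ?thesis by simp
    next
      case False
      then have "sat b j" using prem that(2) merge_joins merge_sat_new by blast
      with ag show ?thesis by (rule agrees_merge)
    qed
  qed
  have "forced p \<Longrightarrow> \<forall>j\<in>set js. j < m \<Longrightarrow> forced (fold merge js p)" for js p
    by (induction js arbitrary: p) (simp_all add: step)
  then have "forced (merge_all F)"
    unfolding merge_all_def by (simp add: forced_def agrees_init)
  with assms show ?thesis by (simp add: forced_def)
qed

lemma maximal_merge_all: "maximal (snd (merge_all F))"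
  unfolding maximal_def using agrees_sat[OF merge_all_forced joined_merge_all] by blast

lemma completion_in_sols: "completion F \<in> sols"
  by (auto simp: completion_def sols_def maximal_merge_all)

subsection \<open>Reachability by vertex flips\<close>

text \<open>The truth vector after flipping vertex \<open>v\<close>, computed from the bits alone.
  Each endpoint equal to \<open>v\<close> toggles the bit, so a loop at \<open>v\<close> is toggled
  twice and stays as it is.\<close>

definition flip_bits :: "bool list \<Rightarrow> nat \<Rightarrow> nat \<Rightarrow> bool" where
  "flip_bits \<sigma> v j \<longleftrightarrow> (\<sigma> ! j \<noteq> (U j = v)) \<noteq> (V j = v)"

definition links :: "(nat \<Rightarrow> bool) \<Rightarrow> (nat \<times> nat) set" where
  "links P = {(u, v). \<exists>j<m. P j \<and> (u = U j \<and> v = V j \<or> u = V j \<and> v = U j)}"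

lemma flip_bits_sig: "j < m \<Longrightarrow> flip_bits (sig a) v j = sat (a(v := \<not> a v)) j"
  by (auto simp: flip_bits_def sat_def)

lemma sym_links: "sym (links P)"
  by (auto simp: links_def sym_def)

lemma links_mono: "(\<And>j. j < m \<Longrightarrow> P j \<Longrightarrow> Q j) \<Longrightarrow> links P \<subseteq> links Q"
  by (auto simp: links_def)

lemma links_rtrancl_sym: "(u, v) \<in> (links P)\<^sup>* \<Longrightarrow> (v, u) \<in> (links P)\<^sup>*"
  using sym_links sym_rtrancl symD by metis

text \<open>If satisfied clauses did not connect the ends of clause \<open>j\<close>, complementing
  \<open>a\<close> on the part \<open>D\<close> around one end would keep them all, as none crosses
  the border of \<open>D\<close>, and would repair \<open>j\<close>.\<close>

lemma maximal_connected:
  assumes "maximal a"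
  shows "(links (\<lambda>_. True))\<^sup>* = (links (sat a))\<^sup>*"
proof -
  have edge: "(U j, V j) \<in> (links (sat a))\<^sup>*" if "j < m" for j
  proof (rule ccontr)
    assume no: "(U j, V j) \<notin> (links (sat a))\<^sup>*"
    define D where "D = {w. (U j, w) \<in> (links (sat a))\<^sup>*}"
    define b where "b w \<longleftrightarrow> a w \<noteq> (w \<in> D)" for w
    have nsat: "\<not> sat a j" using no that by (auto simp: links_def)
    have "sat b i" if "i < m" "sat a i" for i
    proof -
      have "(U i, V i) \<in> links (sat a)" "(V i, U i) \<in> links (sat a)"
        using that by (auto simp: links_def)
      then have "U i \<in> D \<longleftrightarrow> V i \<in> D"
        unfolding D_def mem_Collect_eq by (intro iffI) (erule (1) rtrancl_into_rtrancl)+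
      with that show ?thesis by (auto simp: sat_def b_def)
    qed
    moreover have "U j \<in> D" "V j \<notin> D" using no by (auto simp: D_def)
    then have "sat b j" using nsat by (auto simp: sat_def b_def)
    ultimately show False using assms nsat that unfolding maximal_def by blast
  qed
  have "links (\<lambda>_. True) \<subseteq> (links (sat a))\<^sup>*"
    using edge links_rtrancl_sym by (auto simp: links_def)
  moreover have "links (sat a) \<subseteq> links (\<lambda>_. True)"
    by (rule links_mono) simp
  ultimately show ?thesis
    by (intro antisym rtrancl_subset_rtrancl rtrancl_mono)
qed

lemma links_path_agree:
  assumes "(u, v) \<in> (links (\<lambda>j. sat a j \<and> sat b j))\<^sup>*"
  shows "(a u \<noteq> a v) = (b u \<noteq> b v)"
  using assms by (induction rule: rtrancl_induct) (auto simp: links_def sat_def)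

text \<open>
  Fix a target \<open>b\<close> and a root in each component. The set of vertices connected to their root by
  clauses that both \<open>a\<close> and \<open>b\<close> satisfy can be enlarged by a vertex flip followed by a
  completion, unless it consists of all vertices.
\<close>

lemma closed_subset_sols:
  assumes "S \<subseteq> sols" "S \<noteq> {}"
    and closed: "\<And>\<sigma> v. \<sigma> \<in> S \<Longrightarrow> v \<in> verts \<Longrightarrow> completion (flip_bits \<sigma> v) \<in> S"
  shows "S = sols"
proof (rule antisym[OF assms(1)], rule subsetI)
  fix \<tau> assume "\<tau> \<in> sols"
  then obtain b where b: "maximal b" "\<tau> = sig b" by (auto simp: sols_def)
  define G where "G = links (\<lambda>_. True)"
  define H where "H a = links (\<lambda>j. sat a j \<and> sat b j)" for a
  \<comment> \<open>The choice depends only on the set of vertices connected to \<open>v\<close>, so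
    it is the same throughout a component; see \<open>root_eq\<close>.\<close>
  define root where "root v = (SOME r. (r, v) \<in> G\<^sup>*)" for v
  define R where "R a = {v \<in> verts. (root v, v) \<in> (H a)\<^sup>*}" for a
  have root: "(root v, v) \<in> G\<^sup>*" for v
    unfolding root_def by (rule someI[of _ v]) simp
  have root_eq: "root u = root v" if "(u, v) \<in> G\<^sup>*" for u v
  proof -
    have "(r, u) \<in> G\<^sup>* \<longleftrightarrow> (r, v) \<in> G\<^sup>*" for r
      using that links_rtrancl_sym[OF that[unfolded G_def]] unfolding G_def by (meson rtrancl_trans)
    then show ?thesis by (simp add: root_def)
  qed
  have HG: "(H a)\<^sup>* \<subseteq> G\<^sup>*" for a
    unfolding H_def G_def by (intro rtrancl_mono links_mono) simp
  have bound: "card (R a) \<le> card verts" for a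
    by (rule card_mono) (auto simp: R_def)
  obtain a0 where a0: "maximal a0" "sig a0 \<in> S"
    using assms(1,2) by (auto simp: sols_def)
  define good where "good a \<longleftrightarrow> maximal a \<and> sig a \<in> S" for a
  \<comment> \<open>An extremal choice replaces the iteration of flips: a largest \<open>R a\<close>
    that is not all of \<open>verts\<close> will be enlarged.\<close>
  obtain a where a: "good a" and amax: "\<And>a'. good a' \<Longrightarrow> card (R a') \<le> card (R a)"
    using ex_has_greatest_nat[of good a0 "\<lambda>a. card (R a)" "Suc (card verts)"] a0 bound
    by (auto simp: good_def less_Suc_eq_le)
  have "R a = verts"
  proof (rule ccontr)
    assume "R a \<noteq> verts"
    then obtain v where v: "v \<in> verts" "(root v, v) \<notin> (H a)\<^sup>*" by (auto simp: R_def)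
    \<comment> \<open>A path of clauses satisfied by \<open>b\<close> that ends outside the
      reachable set must cross its border. The outer end of a crossing edge is the vertex to
      flip.\<close>
    have exit: "\<exists>x y. (r, x) \<in> (H a)\<^sup>* \<and> (r, y) \<notin> (H a)\<^sup>* \<and> (x, y) \<in> links (sat b)"
      if "(r, z) \<in> (links (sat b))\<^sup>*" "(r, z) \<notin> (H a)\<^sup>*" for r z
      using that
    proof (induction rule: rtrancl_induct)
      case (step y z)
      show ?case
      proof (cases "(r, y) \<in> (H a)\<^sup>*")
        case True
        with step.hyps(2) step.prems show ?thesis by (intro exI conjI)
      qed (rule step.IH)
    qed simp
    have "(root v, v) \<in> (links (sat b))\<^sup>*"
      using root maximal_connected[OF b(1)] by (simp add: G_def)
    from exit[OF this v(2)]
    obtain x y where xy: "(root v, x) \<in> (H a)\<^sup>*" "(root v, y) \<notin> (H a)\<^sup>*" "(x, y) \<in> links (sat b)"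
      by blast
    then have "(x, y) \<in> G" by (auto simp: G_def links_def)
    have "(root v, y) \<in> G\<^sup>*"
      using xy(1) HG \<open>(x, y) \<in> G\<close> by (meson rtrancl.rtrancl_into_rtrancl subsetD)
    then have rooty: "root y = root v"
      using root_eq[OF \<open>(root v, y) \<in> G\<^sup>*\<close>] root_eq[OF root[of v]] by simp
    have yv: "y \<in> verts" using xy(3) by (auto simp: links_def verts_def)
    define a' where "a' = a(y := \<not> a y)"
    define a'' where "a'' = snd (merge_all (flip_bits (sig a) y))"
    have ext: "sat a'' j" if "j < m" "sat a' j" for j
      unfolding a''_def
      by (rule completion_extends[where b = a']) (use that in \<open>simp_all add: flip_bits_sig a'_def\<close>)
    have good'': "good a''"
      using closed[of "sig a" y] a yv maximal_merge_all unfolding good_def completion_def a''_def by blast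
    \<comment> \<open>The flip affects only clauses at \<open>y\<close>, and no path of common
      clauses from a root meets \<open>y\<close>: in its own component \<open>y\<close> is
      unreachable from the root, and in the others it does not occur.\<close>
    have keep: "(root z, z') \<in> (H a'')\<^sup>*" if "(root z, z') \<in> (H a)\<^sup>*" for z z'
      using that
    proof (induction rule: rtrancl_induct)
      case (step p q)
      have ne: "w \<noteq> y" if "(root z, w) \<in> (H a)\<^sup>*" for w
      proof
        assume "w = y"
        with that have "(root z, y) \<in> G\<^sup>*" using HG by blast
        then have "root z = root y" using root_eq root by metis
        with that \<open>w = y\<close> xy(2) rooty show False by simp
      qed
      have "p \<noteq> y" "q \<noteq> y" using ne step.hyps by (blast, meson rtrancl.rtrancl_into_rtrancl ne)
      with step.hyps(2) obtain i where i: "i < m" "sat a i" "sat b i" "U i \<noteq> y" "V i \<noteq> y"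
          "p = U i \<and> q = V i \<or> p = V i \<and> q = U i"
        by (auto simp: H_def links_def)
      then have "sat a'' i" using ext[of i] by (simp add: sat_def a'_def)
      with i have "(p, q) \<in> H a''" by (auto simp: H_def links_def)
      with step.IH show ?case by (rule rtrancl_into_rtrancl)
    qed simp
    have "x \<noteq> y" using xy(1,2) by auto
    have "(x, y) \<notin> H a" using xy(1,2) by (meson rtrancl.rtrancl_into_rtrancl)
    with xy(3) obtain i where i: "i < m" "\<not> sat a i" "sat b i"
        "x = U i \<and> y = V i \<or> x = V i \<and> y = U i"
      by (auto simp: H_def links_def)
    \<comment> \<open>Clause \<open>i\<close> was violated by \<open>a\<close>, and exactly one of
      its ends has been flipped.\<close>
    then have "sat a'' i" using ext[of i] \<open>x \<noteq> y\<close> by (auto simp: sat_def a'_def)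
    with i have "(x, y) \<in> H a''" by (auto simp: H_def links_def)
    then have "y \<in> R a''"
      using keep[OF xy(1)] yv rooty by (auto simp: R_def intro: rtrancl_into_rtrancl)
    moreover have "y \<notin> R a" using xy(2) rooty by (simp add: R_def)
    moreover have "R a \<subseteq> R a''" using keep by (auto simp: R_def)
    ultimately have "card (R a) < card (R a'')"
      by (intro psubset_card_mono) (auto simp: R_def)
    with amax[OF good''] show False by simp
  qed
  have "sat a j = sat b j" if "j < m" for j
  proof -
    have "U j \<in> R a" "V j \<in> R a" using that \<open>R a = verts\<close> by (auto simp: verts_def)
    moreover have "root (U j) = root (V j)"
      by (rule root_eq) (use that in \<open>auto simp: G_def links_def\<close>)
    ultimately have "(U j, V j) \<in> (H a)\<^sup>*"
      unfolding R_def H_def using links_rtrancl_sym by (metis (no_types, lifting) mem_Collect_eq rtrancl_trans)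
    then show ?thesis using links_path_agree unfolding H_def sat_def by blast
  qed
  then have "sig a = \<tau>" by (simp add: b(2) sig_def)
  with a show "\<tau> \<in> S" by (simp add: good_def)
qed

end

section \<open>A language with bounded loops and eight arrays\<close>

text \<open>
  Loops run over all clause indices, that is from \<open>0\<close> to \<open>m - 1\<close>. The eight arrays are infinite and
  interleaved above the address \<open>B\<close>, so that they can be indexed by variables and by
  the numeric codes of signatures; cell \<open>i\<close> of array \<open>t\<close> has the address \<open>B + 8 * i + t\<close>.
\<close>

datatype hcom =
    HConst nat nat
  | HAdd nat nat nat
  | HSub nat nat nat
  | HGet nat nat nat
  | HPut nat nat nat
  | HRaw nat nat
  | HWrite nat
  | HSeq hcom hcom (infixr ";;" 60)
  | HIf nat hcom hcom
  | HFor nat hcom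

record env =
  vr :: "nat \<Rightarrow> nat"
  ar :: "nat \<Rightarrow> nat \<Rightarrow> nat"
  inp :: "nat \<Rightarrow> nat"
  ob :: "nat list"

definition setr :: "nat \<Rightarrow> nat \<Rightarrow> env \<Rightarrow> env" where
  "setr r x e = e\<lparr>vr := (vr e)(r := x)\<rparr>"

definition seta :: "nat \<Rightarrow> nat \<Rightarrow> nat \<Rightarrow> env \<Rightarrow> env" where
  "seta t i x e = e\<lparr>ar := (ar e)(t := (ar e t)(i := x))\<rparr>"

lemma setr_simps [simp]:
  "vr (setr r x e) r' = (if r' = r then x else vr e r')"
  "ar (setr r x e) = ar e" "inp (setr r x e) = inp e" "ob (setr r x e) = ob e"
  by (simp_all add: setr_def)

lemma seta_simps [simp]:
  "ar (seta t i x e) t' = (if t' = t then (ar e t)(i := x) else ar e t')"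
  "vr (seta t i x e) = vr e" "inp (seta t i x e) = inp e" "ob (seta t i x e) = ob e"
  by (simp_all add: seta_def)

lemma setr_setr [simp]: "setr r x (setr r y e) = setr r x e"
  by (simp add: setr_def)

text \<open>\<open>HRaw\<close> takes an absolute address; decoding addresses from \<open>B\<close>
  on as array cells makes its meaning exact without a side condition. After \<open>HFor\<close> the
  counter is \<open>m\<close>, as the compiled loop leaves it.\<close>

primrec ev :: "nat \<Rightarrow> nat \<Rightarrow> hcom \<Rightarrow> env \<Rightarrow> env" where
  "ev m B (HConst r n) e = setr r n e"
| "ev m B (HAdd r x y) e = setr r (vr e x + vr e y) e"
| "ev m B (HSub r x y) e = setr r (vr e x - vr e y) e"
| "ev m B (HGet r t i) e = setr r (ar e t (vr e i)) e"
| "ev m B (HPut t i r) e = seta t (vr e i) (vr e r) e"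
| "ev m B (HRaw r p) e =
     setr r (if vr e p < B then inp e (vr e p) else ar e ((vr e p - B) mod 8) ((vr e p - B) div 8)) e"
| "ev m B (HWrite r) e = e\<lparr>ob := ob e @ [vr e r]\<rparr>"
| "ev m B (c ;; d) e = ev m B d (ev m B c e)"
| "ev m B (HIf r c d) e = (if vr e r \<noteq> 0 then ev m B c e else ev m B d e)"
| "ev m B (HFor j b) e = setr j m (fold (\<lambda>k e. ev m B b (setr j k e)) [0..<m] e)"

primrec written_regs :: "hcom \<Rightarrow> nat set" where
  "written_regs (HConst r n) = {r}"
| "written_regs (HAdd r x y) = {r}"
| "written_regs (HSub r x y) = {r}"
| "written_regs (HGet r t i) = {r}"
| "written_regs (HPut t i r) = {}"
| "written_regs (HRaw r p) = {r}"
| "written_regs (HWrite r) = {}"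
| "written_regs (c ;; d) = written_regs c \<union> written_regs d"
| "written_regs (HIf r c d) = written_regs c \<union> written_regs d"
| "written_regs (HFor j b) = insert j (written_regs b)"

primrec written_arrs :: "hcom \<Rightarrow> nat set" where
  "written_arrs (HConst r n) = {}"
| "written_arrs (HAdd r x y) = {}"
| "written_arrs (HSub r x y) = {}"
| "written_arrs (HGet r t i) = {}"
| "written_arrs (HPut t i r) = {t}"
| "written_arrs (HRaw r p) = {}"
| "written_arrs (HWrite r) = {}"
| "written_arrs (c ;; d) = written_arrs c \<union> written_arrs d"
| "written_arrs (HIf r c d) = written_arrs c \<union> written_arrs d"
| "written_arrs (HFor j b) = written_arrs b"

primrec silent :: "hcom \<Rightarrow> bool" where
  "silent (HConst r n) = True"
| "silent (HAdd r x y) = True"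
| "silent (HSub r x y) = True"
| "silent (HGet r t i) = True"
| "silent (HPut t i r) = True"
| "silent (HRaw r p) = True"
| "silent (HWrite r) = False"
| "silent (c ;; d) = (silent c \<and> silent d)"
| "silent (HIf r c d) = (silent c \<and> silent d)"
| "silent (HFor j b) = silent b"

text \<open>The limit 8 on constants and array numbers keeps them within the minimal word length 4
  used in \<open>runs\<close>.\<close>

primrec well_formed :: "hcom \<Rightarrow> bool" where
  "well_formed (HConst r n) = (n < 8)"
| "well_formed (HAdd r x y) = True"
| "well_formed (HSub r x y) = True"
| "well_formed (HGet r t i) = (t < 8)"
| "well_formed (HPut t i r) = (t < 8)"
| "well_formed (HRaw r p) = True"
| "well_formed (HWrite r) = True"
| "well_formed (c ;; d) = (well_formed c \<and> well_formed d)"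
| "well_formed (HIf r c d) = (well_formed c \<and> well_formed d)"
| "well_formed (HFor j b) = (j \<notin> written_regs b \<and> well_formed b)"

section \<open>Frame properties and the loop rule\<close>

definition unchanged :: "hcom \<Rightarrow> env \<Rightarrow> env \<Rightarrow> bool" where
  "unchanged c e e' \<longleftrightarrow>
     (\<forall>r. r \<notin> written_regs c \<longrightarrow> vr e' r = vr e r) \<and>
     (\<forall>t. t \<notin> written_arrs c \<longrightarrow> ar e' t = ar e t) \<and>
     inp e' = inp e \<and> (silent c \<longrightarrow> ob e' = ob e)"

lemma unchanged_fold:
  assumes "\<And>e. unchanged b e (ev m B b e)"
  shows "unchanged (HFor j b) e (fold (\<lambda>k e. ev m B b (setr j k e)) ks e)"
proof (induction ks arbitrary: e)
  case (Cons k ks)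
  show ?case
    using Cons.IH[of "ev m B b (setr j k e)"] assms[of "setr j k e"] by (auto simp: unchanged_def)
qed (simp add: unchanged_def)

lemma unchanged_ev: "unchanged c e (ev m B c e)"
proof (induction c arbitrary: e)
  case (HSeq c d)
  then show ?case
    by (simp add: unchanged_def)
next
  case (HFor j b)
  then show ?case
    using unchanged_fold[of b m B j e "[0..<m]"] by (auto simp: unchanged_def)
qed (auto simp: unchanged_def)

lemma ev_frame:
  "r \<notin> written_regs c \<Longrightarrow> vr (ev m B c e) r = vr e r"
  "t \<notin> written_arrs c \<Longrightarrow> ar (ev m B c e) t = ar e t"
  "inp (ev m B c e) = inp e"
  "silent c \<Longrightarrow> ob (ev m B c e) = ob e"
  using unchanged_ev[of c e m B] by (auto simp: unchanged_def)

text \<open>The step receives \<open>unchanged\<close> relative to the state before the loop, so an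
  invariant need only mention what the loop modifies. The counter is set outside the body, hence the
  premise \<open>indep\<close>.\<close>

lemma ev_for_induct:
  assumes "well_formed (HFor j b)"
    and init: "I 0 e"
    and step: "\<And>k e'. k < m \<Longrightarrow> I k e' \<Longrightarrow> vr e' j = k \<Longrightarrow> unchanged (HFor j b) e e'
      \<Longrightarrow> I (Suc k) (ev m B b e')"
    and indep: "\<And>k x e'. I k e' \<Longrightarrow> I k (setr j x e')"
  shows "I m (ev m B (HFor j b) e)"
proof -
  let ?f = "\<lambda>k. fold (\<lambda>k e. ev m B b (setr j k e)) [0..<k] e"
  have "k \<le> m \<Longrightarrow> I k (?f k)" for k
  proof (induction k)
    case (Suc k)
    have "unchanged (HFor j b) e (setr j k (?f k))"
      using unchanged_fold[of b m B j e "[0..<k]", OF unchanged_ev] by (auto simp: unchanged_def)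
    then have "I (Suc k) (ev m B b (setr j k (?f k)))"
      using Suc by (intro step indep) auto
    then show ?case by simp
  qed (use init in simp)
  then show ?thesis by (simp add: indep)
qed

subsection \<open>Compilation\<close>

text \<open>
  Register \<open>r\<close> is kept in the machine register \<open>r + 5\<close>. The machine registers \<open>0\<close> and \<open>1\<close> are
  scratch, \<open>2\<close> holds the constant one, \<open>3\<close> holds \<open>m\<close>, and \<open>4\<close> holds \<open>B\<close>.
\<close>

fun seqs :: "com list \<Rightarrow> com" where
  "seqs [] = Do Nop"
| "seqs (c # cs) = Seq c (seqs cs)"

definition addr_code :: "nat \<Rightarrow> nat \<Rightarrow> com" where
  "addr_code t i = seqs [Do (Add 1 (i + 5) (i + 5)), Do (Add 1 1 1), Do (Add 1 1 1),
     Do (Add 1 1 4), Do (Const 0 t), Do (Add 1 1 0)]"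

primrec compile :: "hcom \<Rightarrow> com" where
  "compile (HConst r n) = Do (Const (r + 5) n)"
| "compile (HAdd r x y) = Do (Add (r + 5) (x + 5) (y + 5))"
| "compile (HSub r x y) = Do (Sub (r + 5) (x + 5) (y + 5))"
| "compile (HGet r t i) = Seq (addr_code t i) (Do (Load (r + 5) 1))"
| "compile (HPut t i r) = Seq (addr_code t i) (Do (Store 1 (r + 5)))"
| "compile (HRaw r p) = Do (Load (r + 5) (p + 5))"
| "compile (HWrite r) = Do (Write (r + 5))"
| "compile (c ;; d) = Seq (compile c) (compile d)"
| "compile (HIf r c d) = Cond (r + 5) (compile c) (compile d)"
| "compile (HFor j b) = seqs [Do (Const (j + 5) 0), Do (Sub 0 3 (j + 5)),
     While 0 (seqs [compile b, Do (Add (j + 5) (j + 5) 2), Do (Sub 0 3 (j + 5))])]"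

text \<open>An upper bound that ignores data: both branches of a conditional are added. An access
  costs six address instructions, the \<open>Nop\<close> ending \<open>seqs\<close>, and the access
  itself. Each loop round pays for its test, two counter updates and a \<open>Nop\<close>.\<close>

primrec nsteps :: "nat \<Rightarrow> hcom \<Rightarrow> nat" where
  "nsteps m (HConst r n) = 1"
| "nsteps m (HAdd r x y) = 1"
| "nsteps m (HSub r x y) = 1"
| "nsteps m (HGet r t i) = 8"
| "nsteps m (HPut t i r) = 8"
| "nsteps m (HRaw r p) = 1"
| "nsteps m (HWrite r) = 1"
| "nsteps m (c ;; d) = nsteps m c + nsteps m d"
| "nsteps m (HIf r c d) = 1 + nsteps m c + nsteps m d"
| "nsteps m (HFor j b) = 4 + m * (nsteps m b + 4)"

lemma nsteps_poly: "\<exists>p. \<forall>m. nsteps m c = poly p m"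
proof (induction c)
  case (HSeq c d)
  then obtain p q where "\<forall>m. nsteps m c = poly p m" "\<forall>m. nsteps m d = poly q m" by blast
  then show ?case by (intro exI[of _ "p + q"]) simp
next
  case (HIf r c d)
  then obtain p q where "\<forall>m. nsteps m c = poly p m" "\<forall>m. nsteps m d = poly q m" by blast
  then show ?case by (intro exI[of _ "[:1:] + p + q"]) simp
next
  case (HFor j b)
  then obtain p where "\<forall>m. nsteps m b = poly p m" by blast
  then show ?case by (intro exI[of _ "[:4:] + [:0, 1:] * (p + [:4:])"]) simp
qed (auto intro: exI[of _ "[:1:]"] exI[of _ "[:8:]"])

section \<open>Word length and running time of machine code\<close>

definition bounded :: "nat \<Rightarrow> state \<Rightarrow> bool" where
  "bounded w s \<longleftrightarrow> (\<forall>r. regs s r < 2 ^ w) \<and> (\<forall>i. mem s i < 2 ^ w)"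

text \<open>
  An addition lengthens the longest number by at most one bit, so the cost of \<open>n\<close> steps is
  controlled by \<open>n\<close> and the initial word length alone.
\<close>

definition runs :: "nat \<Rightarrow> com \<Rightarrow> state \<Rightarrow> state \<Rightarrow> bool" where
  "runs n c s t \<longleftrightarrow> exec c s t \<and> outs t = outs s \<and>
     (\<forall>w\<ge>4. bounded w s \<longrightarrow> bounded (w + n) t \<and> clock t \<le> clock s + 2 * n * (w + n))"

lemma word_size_le: "x < 2 ^ w \<Longrightarrow> 1 \<le> w \<Longrightarrow> word_size x \<le> w"
  by (simp add: word_size_def floorlog_leI)

lemma bounded_mono: "bounded w s \<Longrightarrow> w \<le> w' \<Longrightarrow> bounded w' s"
  unfolding bounded_def by (meson less_le_trans one_le_numeral power_increasing)

lemma bounded_tick [simp]: "bounded w (tick k s) = bounded w s"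
  by (simp add: bounded_def tick_def)

lemma tick_simps [simp]:
  "regs (tick k s) = regs s" "mem (tick k s) = mem s" "buf (tick k s) = buf s"
  "outs (tick k s) = outs s" "clock (tick k s) = clock s + k"
  by (simp_all add: tick_def)

lemma runs_mono:
  assumes "runs n c s t" "n \<le> n'"
  shows "runs n' c s t"
proof -
  have "2 * n * (w + n) \<le> 2 * n' * (w + n')" for w
    using assms(2) by (intro mult_le_mono) auto
  then show ?thesis
    using assms unfolding runs_def by (meson add_left_mono bounded_mono order_trans)
qed

text \<open>The second of two consecutive parts starts with words of \<open>w + a\<close> bits; the
  budget \<open>2 * n * (w + n)\<close> is chosen so that this still composes.\<close>

lemma steps_add_le: "2 * a * (w + a) + 2 * b * (w + a + b) \<le> 2 * (a + b) * (w + (a + b) :: nat)"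
proof -
  have "2 * a * (w + a) \<le> 2 * a * (w + (a + b))" by (intro mult_le_mono) auto
  then show ?thesis by (simp add: algebra_simps)
qed

lemma runs_trans_time:
  assumes "\<forall>w\<ge>4. bounded w s \<longrightarrow> bounded (w + a) s' \<and> clock s' \<le> clock s + 2 * a * (w + a)"
    and "\<forall>w\<ge>4. bounded w s' \<longrightarrow> bounded (w + b) s'' \<and> clock s'' \<le> clock s' + 2 * b * (w + b)"
  shows "\<forall>w\<ge>4. bounded w s \<longrightarrow>
    bounded (w + (a + b)) s'' \<and> clock s'' \<le> clock s + 2 * (a + b) * (w + (a + b))"
proof (intro allI impI)
  fix w :: nat assume w: "4 \<le> w" "bounded w s"
  then have "bounded (w + a) s'" "clock s' \<le> clock s + 2 * a * (w + a)" using assms(1) by auto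
  moreover from this have "bounded (w + a + b) s''" "clock s'' \<le> clock s' + 2 * b * (w + a + b)"
    using assms(2) w(1) by (auto simp del: add.assoc)
  ultimately show "bounded (w + (a + b)) s'' \<and> clock s'' \<le> clock s + 2 * (a + b) * (w + (a + b))"
    using steps_add_le[of a w b] by (simp add: add.assoc)
qed

lemma runs_Seq:
  assumes "runs a c s s'" "runs b d s' s''"
  shows "runs (a + b) (Seq c d) s s''"
  using assms runs_trans_time[of s a s' b s''] unfolding runs_def by (auto intro: exec.Seq)

lemma tick_time:
  assumes "bounded w s" "4 \<le> w"
  shows "clock (tick (word_size (regs s r)) s) \<le> clock s + 2 * 1 * (w + 1)"
  using word_size_le[of "regs s r" w] assms by (auto simp: bounded_def)

lemma runs_tick:
  assumes "runs n c (tick (word_size (regs s r)) s) t"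
  shows "\<forall>w\<ge>4. bounded w s \<longrightarrow> bounded (w + (1 + n)) t \<and> clock t \<le> clock s + 2 * (1 + n) * (w + (1 + n))"
  by (rule runs_trans_time[where s' = "tick (word_size (regs s r)) s"])
    (use assms tick_time bounded_mono in \<open>auto simp: runs_def simp del: tick_simps\<close>)

lemma runs_CondTrue:
  "regs s r \<noteq> 0 \<Longrightarrow> runs n c (tick (word_size (regs s r)) s) t \<Longrightarrow> runs (1 + n) (Cond r c d) s t"
  using runs_tick[of n c s r t] unfolding runs_def by (auto intro: exec.CondTrue)

lemma runs_CondFalse:
  "regs s r = 0 \<Longrightarrow> runs n d (tick (word_size (regs s r)) s) t \<Longrightarrow> runs (1 + n) (Cond r c d) s t"
  using runs_tick[of n d s r t] unfolding runs_def by (auto intro: exec.CondFalse)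

lemma runs_WhileFalse:
  "regs s r = 0 \<Longrightarrow> runs 1 (While r c) s (tick (word_size (regs s r)) s)"
  using tick_time[of _ s r] bounded_mono exec.WhileFalse[of s r c] unfolding runs_def
  by (auto simp del: tick_simps simp: tick_simps(4))

lemma runs_WhileTrue:
  assumes "regs s r \<noteq> 0" "runs a c (tick (word_size (regs s r)) s) s'" "runs b (While r c) s' s''"
  shows "runs (1 + a + b) (While r c) s s''"
  using runs_trans_time[OF runs_tick[OF assms(2)], of b s''] assms exec.WhileTrue[OF assms(1)]
  unfolding runs_def by auto

definition run1 :: "instr \<Rightarrow> state \<Rightarrow> state" where
  "run1 i s = effect i (tick (cost i s) s)"

fun plain_instr :: "instr \<Rightarrow> bool" where
  "plain_instr Emit = False"
| "plain_instr (Const r n) = (n < 8)"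
| "plain_instr _ = True"

text \<open>A sum of two numbers of \<open>w\<close> bits has at most \<open>w + 1\<close> bits, and
  an instruction is charged for at most two numbers of \<open>w\<close> bits.\<close>

lemma runs_Do:
  assumes "plain_instr i"
  shows "runs 1 (Do i) s (run1 i s)"
proof -
  have "bounded (w + 1) (run1 i s) \<and>
      clock (run1 i s) \<le> clock s + 2 * 1 * (w + 1)"
    if w: "4 \<le> w" "bounded w s" for w
  proof
    have R: "regs s r < 2 ^ w" and M: "mem s r < 2 ^ w" for r
      using w(2) by (auto simp: bounded_def)
    have R': "regs s r < 2 * 2 ^ w" and M': "mem s r < 2 * 2 ^ w" for r
      using R[of r] M[of r] by linarith+
    have A: "regs s r + regs s r' < 2 * 2 ^ w" and S: "regs s r - regs s r' < 2 * 2 ^ w" for r r'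
      using R[of r] R[of r'] by linarith+
    have "(2::nat) ^ 4 \<le> 2 ^ w" using w(1) by (intro power_increasing) auto
    then have C: "n < 2 * 2 ^ w" "n < 2 ^ w" if "n < 8" for n :: nat
      using that by auto
    show "bounded (w + 1) (run1 i s)"
      using assms R' M' A S C by (cases i) (auto simp: bounded_def run1_def)
    have W: "word_size (regs s r) \<le> w" "word_size (mem s r) \<le> w" for r
      using R[of r] M[of r] w(1) by (auto intro: word_size_le)
    have WC: "word_size n \<le> w" if "n < 8" for n :: nat
      using C(2)[OF that] w(1) by (auto intro: word_size_le)
    have "cost i s \<le> 2 * w"
      using assms W WC w(1)
      by (cases i) (auto simp: mult_2 intro: add_mono trans_le_add1)
    then show "clock (run1 i s) \<le> clock s + 2 * 1 * (w + 1)"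
      by (cases i) (auto simp: run1_def)
  qed
  moreover have "outs (run1 i s) = outs s"
    using assms by (cases i) (auto simp: run1_def)
  ultimately show ?thesis using exec.Do[of i s] by (simp add: runs_def run1_def)
qed

section \<open>Simulation of the loop language by the machine\<close>

definition rel :: "nat \<Rightarrow> nat \<Rightarrow> env \<Rightarrow> state \<Rightarrow> bool" where
  "rel m B e s \<longleftrightarrow> (\<forall>r. regs s (r + 5) = vr e r) \<and> regs s 2 = 1 \<and> regs s 3 = m \<and> regs s 4 = B \<and>
     (\<forall>i<B. mem s i = inp e i) \<and> (\<forall>t<8. \<forall>i. mem s (B + 8 * i + t) = ar e t i) \<and> buf s = ob e"

lemma rel_tick [simp]: "rel m B e (tick k s) = rel m B e s"
  by (simp add: rel_def)

lemma rel_set: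
  assumes "rel m B e s" "regs t = (regs s)(r + 5 := x)" "mem t = mem s" "buf t = buf s"
  shows "rel m B (setr r x e) t"
  using assms by (auto simp: rel_def)

text \<open>By division with remainder every address from \<open>B\<close> on is an array cell, so
  \<open>rel\<close> determines the whole memory. This is what later bounds all its cells.\<close>

lemma mem_rel:
  assumes "rel m B e s"
  shows "mem s a = (if a < B then inp e a else ar e ((a - B) mod 8) ((a - B) div 8))"
proof (cases "a < B")
  case False
  then have "a = B + 8 * ((a - B) div 8) + (a - B) mod 8" by simp
  then show ?thesis using assms False unfolding rel_def by (metis mod_less_divisor zero_less_numeral)
qed (use assms in \<open>simp add: rel_def\<close>)

lemma array_addr_inj:
  fixes t t' :: nat
  assumes "t < 8" "t' < 8" "B + 8 * i + t = B + 8 * i' + t'"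
  shows "i = i' \<and> t = t'"
proof -
  have "8 * i + t = 8 * i' + t'" using assms(3) by simp
  then have "(8 * i + t) div 8 = (8 * i' + t') div 8" "(8 * i + t) mod 8 = (8 * i' + t') mod 8" by simp_all
  then show ?thesis using assms(1,2) by simp
qed

lemma runs_instrs:
  assumes "list_all plain_instr is" "n = length is + 1"
  shows "runs n (seqs (map Do is)) s (run1 Nop (fold run1 is s))"
  using assms
proof (induction "is" arbitrary: s n)
  case Nil
  then show ?case using runs_Do[of Nop s] by simp
next
  case (Cons i "is")
  then show ?case
    using runs_Seq[OF runs_Do[of i s] Cons.IH[of "length is + 1" "run1 i s"]] by simp
qed

lemma addr_code_runs:
  assumes "rel m B e s" "t < 8"
  shows "\<exists>s'. runs 7 (addr_code t i) s s' \<and> rel m B e s' \<and> regs s' 1 = B + 8 * vr e i + t"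
proof -
  let ?is = "[Add 1 (i + 5) (i + 5), Add 1 1 1, Add 1 1 1, Add 1 1 4, Const 0 t, Add 1 1 0]"
  let ?s = "run1 Nop (fold run1 ?is s)"
  have "runs 7 (addr_code t i) s ?s"
    using runs_instrs[of ?is 7 s] assms(2) by (simp add: addr_code_def)
  moreover have "rel m B e ?s" "regs ?s 1 = B + 8 * vr e i + t"
    using assms(1) by (auto simp: rel_def run1_def)
  ultimately show ?thesis by blast
qed

lemma compile_For_runs:
  assumes wf: "well_formed (HFor j b)"
    and body: "\<And>e s. rel m B e s \<Longrightarrow> \<exists>t. runs n (compile b) s t \<and> rel m B (ev m B b e) t"
    and rel: "rel m B e s"
  shows "\<exists>t. runs (4 + m * (n + 4)) (compile (HFor j b)) s t \<and> rel m B (ev m B (HFor j b) e) t"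
proof -
  let ?W = "While 0 (seqs [compile b, Do (Add (j + 5) (j + 5) 2), Do (Sub 0 3 (j + 5))])"
  let ?f = "\<lambda>k. fold (\<lambda>k e. ev m B b (setr j k e)) [0..<k] e"
  \<comment> \<open>Machine register 0 holds the number \<open>d\<close> of rounds left. The body
    may overwrite it as scratch, so it is recomputed from the counter after each round.\<close>
  have loop: "\<exists>t. runs (1 + d * (n + 4)) ?W s t \<and> rel m B (setr j m (?f m)) t"
    if "k + d = m" "rel m B (setr j k (?f k)) s" "regs s 0 = d" for d k s
    using that
  proof (induction d arbitrary: k s)
    case 0
    then show ?case
      using runs_WhileFalse[of s 0] by (intro exI[of _ "tick (word_size (regs s 0)) s"]) simp
  next
    case (Suc d)
    let ?s = "tick (word_size (regs s 0)) s"
    obtain t where t: "runs n (compile b) ?s t" "rel m B (?f (Suc k)) t"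
      using body[of "setr j k (?f k)" ?s] Suc.prems(2) by auto
    let ?is = "[Add (j + 5) (j + 5) 2, Sub 0 3 (j + 5)]"
    let ?t = "run1 Nop (fold run1 ?is t)"
    have "vr (?f (Suc k)) j = k" using wf by (simp add: ev_frame)
    then have rt: "rel m B (setr j (Suc k) (?f (Suc k))) ?t" "regs ?t 0 = d"
      using t(2) Suc.prems(1) by (auto simp: rel_def run1_def)
    have *: "runs (n + 3) (seqs [compile b, Do (Add (j + 5) (j + 5) 2), Do (Sub 0 3 (j + 5))]) ?s ?t"
      using runs_Seq[OF t(1) runs_instrs[of ?is 3 t]] by simp
    obtain u where u: "runs (1 + d * (n + 4)) ?W ?t u" "rel m B (setr j m (?f m)) u"
      using Suc.IH[of "Suc k" ?t] rt Suc.prems(1) by auto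
    have "regs s 0 \<noteq> 0" using Suc.prems(3) by simp
    from runs_WhileTrue[OF this * u(1)] u(2) show ?case
      by (intro exI[of _ u]) (simp add: algebra_simps)
  qed
  let ?is = "[Const (j + 5) 0, Sub 0 3 (j + 5)]"
  let ?s2 = "fold run1 ?is s"
  have "rel m B (setr j 0 e) ?s2" "regs ?s2 0 = m"
    using rel by (auto simp: rel_def run1_def)
  then obtain t where t: "runs (1 + m * (n + 4)) ?W ?s2 t" "rel m B (setr j m (?f m)) t"
    using loop[of 0 m ?s2] by auto
  have "runs (1 + (1 + ((1 + m * (n + 4)) + 1))) (compile (HFor j b)) s (run1 Nop t)"
    unfolding compile.simps seqs.simps
    by (intro runs_Seq[OF runs_Do] runs_Seq[OF _ runs_Do]) (use t(1) in simp_all)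
  moreover have "rel m B (setr j m (?f m)) (run1 Nop t)"
    using t(2) by (simp add: run1_def)
  ultimately show ?thesis by (intro exI[of _ "run1 Nop t"]) (simp add: runs_mono)
qed

lemma compile_runs:
  "well_formed c \<Longrightarrow> rel m B e s \<Longrightarrow> \<exists>t. runs (nsteps m c) (compile c) s t \<and> rel m B (ev m B c e) t"
proof (induction c arbitrary: e s)
  case (HConst r n)
  then show ?case
    by (intro exI[of _ "run1 (Const (r + 5) n) s"])
      (use runs_Do[of "Const (r + 5) n" s] in \<open>auto simp: run1_def rel_def\<close>)
next
  case (HAdd r x y)
  then show ?case
    by (intro exI[of _ "run1 (Add (r + 5) (x + 5) (y + 5)) s"])
      (use runs_Do[of "Add (r + 5) (x + 5) (y + 5)" s] in \<open>auto simp: run1_def rel_def\<close>)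
next
  case (HSub r x y)
  then show ?case
    by (intro exI[of _ "run1 (Sub (r + 5) (x + 5) (y + 5)) s"])
      (use runs_Do[of "Sub (r + 5) (x + 5) (y + 5)" s] in \<open>auto simp: run1_def rel_def\<close>)
next
  case (HGet r t i)
  then obtain s' where s': "runs 7 (addr_code t i) s s'" "rel m B e s'" "regs s' 1 = B + 8 * vr e i + t"
    using addr_code_runs by fastforce
  let ?i = "Load (r + 5) 1"
  have "rel m B (setr r (ar e t (vr e i)) e) (run1 ?i s')"
    by (rule rel_set[OF s'(2)]) (use s'(2,3) HGet.prems in \<open>auto simp: run1_def rel_def\<close>)
  then show ?case
    using runs_Seq[OF s'(1) runs_Do[of ?i]] by (intro exI[of _ "run1 ?i s'"]) auto
next
  case (HPut t i r)
  then obtain s' where s': "runs 7 (addr_code t i) s s'" "rel m B e s'" "regs s' 1 = B + 8 * vr e i + t"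
    using addr_code_runs by fastforce
  let ?i = "Store 1 (r + 5)"
  have "rel m B (seta t (vr e i) (vr e r) e) (run1 ?i s')"
    using s'(2,3) HPut.prems array_addr_inj[of t _ B "vr e i"]
    by (auto simp: run1_def rel_def) (metis array_addr_inj)+
  then show ?case
    using runs_Seq[OF s'(1) runs_Do[of ?i]] by (intro exI[of _ "run1 ?i s'"]) auto
next
  case (HRaw r p)
  let ?i = "Load (r + 5) (p + 5)"
  have "rel m B (ev m B (HRaw r p) e) (run1 ?i s)"
    unfolding ev.simps using HRaw.prems(2)
    by (rule rel_set) (use mem_rel[OF HRaw.prems(2)] HRaw.prems(2) in \<open>auto simp: run1_def rel_def\<close>)
  then show ?case
    using runs_Do[of ?i s] by (intro exI[of _ "run1 ?i s"]) auto
next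
  case (HWrite r)
  then show ?case
    by (intro exI[of _ "run1 (Write (r + 5)) s"])
      (use runs_Do[of "Write (r + 5)" s] in \<open>auto simp: run1_def rel_def\<close>)
next
  case (HSeq c d)
  obtain t where t: "runs (nsteps m c) (compile c) s t" "rel m B (ev m B c e) t"
    using HSeq.IH(1)[of e s] HSeq.prems by auto
  obtain u where "runs (nsteps m d) (compile d) t u" "rel m B (ev m B d (ev m B c e)) u"
    using HSeq.IH(2)[OF _ t(2)] HSeq.prems by auto
  with t show ?case by (auto intro: runs_Seq)
next
  case (HIf r c d)
  let ?s = "tick (word_size (regs s (r + 5))) s"
  have reg: "regs s (r + 5) = vr e r" and rel: "rel m B e ?s"
    using HIf.prems by (simp_all add: rel_def)
  show ?case
  proof (cases "vr e r = 0")
    case False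
    obtain t where "runs (nsteps m c) (compile c) ?s t" "rel m B (ev m B c e) t"
      using HIf.IH(1)[OF _ rel] HIf.prems by auto
    with False reg show ?thesis
      using runs_mono[OF runs_CondTrue[of s "r + 5"], of "nsteps m c" "compile c" t "1 + nsteps m c + nsteps m d"]
      by auto
  next
    case True
    obtain t where "runs (nsteps m d) (compile d) ?s t" "rel m B (ev m B d e) t"
      using HIf.IH(2)[OF _ rel] HIf.prems by auto
    with True reg show ?thesis
      using runs_mono[OF runs_CondFalse[of s "r + 5"], of "nsteps m d" "compile d" t "1 + nsteps m c + nsteps m d"]
      by auto
  qed
next
  case (HFor j b)
  then show ?case using compile_For_runs[of j b m B "nsteps m b" e s] by auto
qed

section \<open>The enumeration program\<close>

text \<open>
  Arrays: \<open>0\<close> and \<open>1\<close> hold the endpoints of the clauses, \<open>2\<close> their right-hand sides, \<open>3\<close> the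
  signature under construction, \<open>4\<close> and \<open>5\<close> the labels and values of the completion, \<open>6\<close> marks the
  codes of the signatures found so far, and \<open>7\<close> is a queue in which every signature occupies \<open>m + 1\<close>
  consecutive cells (the additional cell keeps entries nonempty if there are no clauses).
  Register \<open>13\<close> points to the head of the queue, \<open>14\<close> to its end, and \<open>15\<close> holds their difference.
  Differences are truncated, so \<^term>\<open>(x - y) + (y - x) :: nat\<close> serves both as a test for equality and,
  on bits, as exclusive or.
\<close>

definition absdiff :: "nat \<Rightarrow> nat \<Rightarrow> nat" where
  "absdiff x y = (x - y) + (y - x)"

lemma absdiff_eq_0 [simp]: "absdiff x y = 0 \<longleftrightarrow> x = y"
  by (auto simp: absdiff_def)

lemma absdiff_of_bool [simp]: "absdiff (of_bool a) (of_bool b) = of_bool (a \<noteq> b)"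
  by (cases a; cases b) (simp_all add: absdiff_def)

text \<open>Register 9 takes the reverse difference before \<open>r\<close> is overwritten, since
  \<open>r\<close> may coincide with \<open>x\<close> or \<open>y\<close>.\<close>

definition absdiff_code :: "nat \<Rightarrow> nat \<Rightarrow> nat \<Rightarrow> hcom" where
  "absdiff_code r x y = HSub 9 y x ;; HSub r x y ;; HAdd r r 9"

lemma ev_absdiff_code [simp]:
  "r \<noteq> 9 \<Longrightarrow> x \<noteq> 9 \<Longrightarrow> y \<noteq> 9 \<Longrightarrow>
    ev m B (absdiff_code r x y) e = setr r (absdiff (vr e x) (vr e y)) (setr 9 (vr e y - vr e x) e)"
  by (simp add: absdiff_code_def absdiff_def)

definition relabel_code :: "nat \<Rightarrow> hcom" where
  "relabel_code q = HGet 8 q 4 ;; HGet 10 4 8 ;; absdiff_code 10 10 5 ;;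
     HIf 10 (HConst 10 0) (HPut 4 8 6 ;; HGet 10 5 8 ;; absdiff_code 10 10 7 ;; HPut 5 8 10)"

definition relabel_loop :: hcom where
  "relabel_loop = HFor 4 (relabel_code 0 ;; relabel_code 1)"

text \<open>Before the test, registers 5 and 6 hold the labels of the two ends, and 7 holds the sum
  of both values and the right-hand side, which is 1 iff the clause is violated.
  \<open>HConst 10 0\<close> stands for an empty branch.\<close>

definition merge_code :: hcom where
  "merge_code = HGet 10 0 3 ;; HGet 5 4 10 ;; HGet 7 5 10 ;; HGet 10 1 3 ;; HGet 6 4 10 ;;
     HGet 10 5 10 ;; absdiff_code 7 7 10 ;; HGet 10 2 3 ;; absdiff_code 7 7 10 ;;
     absdiff_code 10 5 6 ;; HIf 10 relabel_loop (HConst 10 0)"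

definition reset_code :: hcom where
  "reset_code = HConst 10 0 ;; HFor 3 (HGet 8 0 3 ;; HPut 4 8 8 ;; HPut 5 8 10 ;;
     HGet 8 1 3 ;; HPut 4 8 8 ;; HPut 5 8 10)"

definition first_pass_code :: hcom where
  "first_pass_code = HFor 3 (HGet 10 3 3 ;; HIf 10 merge_code (HConst 10 0))"

definition second_pass_code :: hcom where
  "second_pass_code = HFor 3 merge_code"

definition signature_code :: hcom where
  "signature_code = HConst 11 1 ;; HFor 3 (HGet 8 0 3 ;; HGet 10 5 8 ;; HGet 8 1 3 ;; HGet 8 5 8 ;;
     absdiff_code 10 10 8 ;; HGet 8 2 3 ;; absdiff_code 10 10 8 ;; HConst 8 1 ;; HSub 10 8 10 ;;
     HPut 3 3 10 ;; HAdd 11 11 11 ;; HAdd 11 11 10)"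

definition completion_code :: hcom where
  "completion_code = reset_code ;; first_pass_code ;; second_pass_code ;; signature_code"

definition push_code :: hcom where
  "push_code = HGet 10 6 11 ;; HIf 10 (HConst 10 0) (HConst 8 1 ;; HPut 6 11 8 ;;
     HFor 3 (HGet 10 3 3 ;; HPut 7 14 10 ;; HAdd 14 14 8) ;; HAdd 14 14 8)"

definition flip_code :: "nat \<Rightarrow> hcom" where
  "flip_code q = HGet 17 q 3 ;; absdiff_code 17 17 12 ;;
     HIf 17 (HConst 17 0) (HConst 17 1 ;; absdiff_code 10 10 17)"

definition neighbour_code :: "nat \<Rightarrow> hcom" where
  "neighbour_code q = HGet 12 q 2 ;;
     HFor 3 (HAdd 10 13 3 ;; HGet 10 7 10 ;; flip_code 0 ;; flip_code 1 ;; HPut 3 3 10) ;;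
     completion_code ;; push_code"

text \<open>Leftover values would have to be bounded anew in every iteration; after clearing, only
  the queue pointers 13, 14 and 15 can be large.\<close>

definition clear_code :: hcom where
  "clear_code = HConst 2 0 ;; HConst 3 0 ;; HConst 4 0 ;; HConst 5 0 ;; HConst 6 0 ;; HConst 7 0 ;;
     HConst 8 0 ;; HConst 9 0 ;; HConst 10 0 ;; HConst 11 0 ;; HConst 12 0 ;; HConst 16 0 ;; HConst 17 0"

definition expand_code :: hcom where
  "expand_code = HFor 2 (neighbour_code 0 ;; neighbour_code 1) ;;
     HConst 8 1 ;; HFor 3 (HAdd 13 13 8) ;; HAdd 13 13 8 ;; HSub 15 14 13 ;; clear_code"

definition output_code :: "bool \<Rightarrow> hcom" where
  "output_code neg = HFor 3 (HAdd 10 13 3 ;; HGet 10 7 10 ;; HConst 8 1 ;;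
     (if neg then HSub 10 8 10 else HConst 9 0) ;; HWrite 10)"

text \<open>Register 5 counts the variables still to be read and 16 is the read position. The
  default 0 is the vertex of the constant; truncated subtraction leaves the count of an empty clause
  at 0 for the second call.\<close>

definition parse_var_code :: "nat \<Rightarrow> hcom" where
  "parse_var_code q = HConst 6 0 ;;
     HIf 5 (HRaw 6 16 ;; HAdd 6 6 8 ;; HAdd 16 16 8) (HConst 6 0) ;; HPut q 3 6"

definition parse_clause_code :: "bool \<Rightarrow> hcom" where
  "parse_clause_code neg = HRaw 5 16 ;; HAdd 16 16 8 ;; parse_var_code 0 ;; HSub 5 5 8 ;;
     parse_var_code 1 ;; HRaw 6 16 ;; HAdd 16 16 8 ;; (if neg then HSub 6 8 6 else HConst 5 0) ;;
     HPut 2 3 6"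

definition parse_code :: "bool \<Rightarrow> hcom" where
  "parse_code neg = HConst 16 1 ;; HConst 8 1 ;; HFor 3 (parse_clause_code neg)"

definition init_code :: "bool \<Rightarrow> hcom" where
  "init_code neg = parse_code neg ;; completion_code ;; push_code ;; HSub 15 14 13 ;; clear_code"

lemmas merge_defs = absdiff_code_def relabel_code_def relabel_loop_def merge_code_def
lemmas completion_defs = merge_defs reset_code_def first_pass_code_def second_pass_code_def
  signature_code_def completion_code_def
lemmas code_defs = completion_defs push_code_def flip_code_def neighbour_code_def clear_code_def
  expand_code_def output_code_def parse_var_code_def parse_clause_code_def parse_code_def init_code_def

lemma ev_frame_code:
  "r \<notin> {4, 5, 6, 7, 8, 9, 10} \<Longrightarrow> vr (ev m B merge_code e) r = vr e r"
  "t \<notin> {4, 5} \<Longrightarrow> ar (ev m B merge_code e) t = ar e t"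
  "r \<notin> {3, 4, 5, 6, 7, 8, 9, 10, 11} \<Longrightarrow> vr (ev m B completion_code e) r = vr e r"
  "t \<notin> {3, 4, 5} \<Longrightarrow> ar (ev m B completion_code e) t = ar e t"
  "t \<notin> {6, 7} \<Longrightarrow> ar (ev m B push_code e) t = ar e t"
  "r \<notin> {3, 4, 5, 6, 7, 8, 9, 10, 11, 12, 14, 17} \<Longrightarrow> vr (ev m B (neighbour_code q) e) r = vr e r"
  by (intro ev_frame; simp add: code_defs)+

text \<open>The bits of the signature as binary digits after a leading 1, most significant
  first.\<close>

definition code :: "bool list \<Rightarrow> nat" where
  "code \<sigma> = fold (\<lambda>b c. c + c + of_bool b) \<sigma> 1"

lemma code_snoc: "code (\<sigma> @ [b]) = code \<sigma> + code \<sigma> + of_bool b"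
  by (simp add: code_def)

lemma code_inj: "length \<sigma> = length \<tau> \<Longrightarrow> code \<sigma> = code \<tau> \<Longrightarrow> \<sigma> = \<tau>"
proof (induction \<sigma> arbitrary: \<tau> rule: rev_induct)
  case (snoc b \<sigma>)
  then obtain c \<rho> where \<tau>: "\<tau> = \<rho> @ [c]" "length \<rho> = length \<sigma>"
    by (cases \<tau> rule: rev_cases) auto
  have eq: "code \<sigma> + code \<sigma> + of_bool b = code \<rho> + code \<rho> + of_bool c"
    using snoc.prems(2) by (simp add: \<tau>(1) code_snoc)
  then have "b = c" by (cases b; cases c; simp; presburger)
  with eq snoc.IH[of \<rho>] \<tau> show ?case by simp
qed simp

section \<open>Correctness of the program on a clause graph with bounded vertices\<close>

locale bounded_graph = clause_graph +
  fixes B X :: nat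
  assumes U_le: "j < m \<Longrightarrow> U j \<le> X" and V_le: "j < m \<Longrightarrow> V j \<le> X" and X_pos: "1 \<le> X"
begin

definition seen :: "nat \<Rightarrow> nat set" where
  "seen k = U ` {..<k} \<union> V ` {..<k}"

lemma seen_0 [simp]: "seen 0 = {}" and seen_m [simp]: "seen m = verts"
  and seen_Suc: "seen (Suc k) = insert (V k) (insert (U k) (seen k))"
  by (auto simp: seen_def verts_def lessThan_Suc)

definition graph_env :: "env \<Rightarrow> bool" where
  "graph_env e \<longleftrightarrow> (\<forall>j<m. ar e 0 j = U j \<and> ar e 1 j = V j \<and> ar e 2 j = of_bool (E j))"

definition cells_le :: "env \<Rightarrow> bool" where
  "cells_le e \<longleftrightarrow> (\<forall>t i. ar e t i \<le> X)"

lemma graph_envD: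
  "graph_env e \<Longrightarrow> j < m \<Longrightarrow> ar e 0 j = U j"
  "graph_env e \<Longrightarrow> j < m \<Longrightarrow> ar e (Suc 0) j = V j"
  "graph_env e \<Longrightarrow> j < m \<Longrightarrow> ar e 2 j = of_bool (E j)"
  by (auto simp: graph_env_def)

lemma graph_env_cong: "ar e' 0 = ar e 0 \<Longrightarrow> ar e' 1 = ar e 1 \<Longrightarrow> ar e' 2 = ar e 2 \<Longrightarrow> graph_env e' = graph_env e"
  by (simp add: graph_env_def)

lemma graph_env_simps [simp]:
  "graph_env (setr r x e) = graph_env e" "t > 2 \<Longrightarrow> graph_env (seta t i x e) = graph_env e"
  by (auto simp: graph_env_def)

lemma cells_le_simps [simp]: "cells_le (setr r x e) = cells_le e"
  by (auto simp: cells_le_def)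

lemma cells_le_seta [simp]: "cells_le e \<Longrightarrow> x \<le> X \<Longrightarrow> cells_le (seta t i x e)"
  by (auto simp: cells_le_def)

lemma of_bool_le [simp]: "of_bool b \<le> X"
  using X_pos by (cases b) auto

lemma in_verts: "j < m \<Longrightarrow> U j \<in> verts" "j < m \<Longrightarrow> V j \<in> verts"
  by (auto simp: verts_def)

subsection \<open>Completion\<close>

lemma ev_relabel_code:
  assumes "q < 2" and "w = ar e q (vr e 4)"
  shows "ar (ev m B (relabel_code q) e) 4 =
      (ar e 4)(w := if ar e 4 w = vr e 5 then vr e 6 else ar e 4 w)"
    and "ar (ev m B (relabel_code q) e) 5 =
      (ar e 5)(w := if ar e 4 w = vr e 5 then absdiff (ar e 5 w) (vr e 7) else ar e 5 w)"
    and "r \<notin> {8, 9, 10} \<Longrightarrow> vr (ev m B (relabel_code q) e) r = vr e r"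
    and "t \<notin> {4, 5} \<Longrightarrow> ar (ev m B (relabel_code q) e) t = ar e t"
  using assms by (auto simp: relabel_code_def)

text \<open>A vertex is visited once for each clause end at it. Later visits have no effect, because
  a relabelled vertex carries \<open>vr e 6\<close>, which differs from
  \<open>vr e 5\<close>.\<close>

lemma ev_relabel_loop:
  assumes "graph_env e" "vr e 5 \<noteq> vr e 6"
  shows "ar (ev m B relabel_loop e) 4 = (\<lambda>w. if w \<in> verts \<and> ar e 4 w = vr e 5 then vr e 6 else ar e 4 w) \<and>
    ar (ev m B relabel_loop e) 5 =
      (\<lambda>w. if w \<in> verts \<and> ar e 4 w = vr e 5 then absdiff (ar e 5 w) (vr e 7) else ar e 5 w)"
proof -
  define LL where "LL D w = (if w \<in> D \<and> ar e 4 w = vr e 5 then vr e 6 else ar e 4 w)" for D w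
  define XX where "XX D w = (if w \<in> D \<and> ar e 4 w = vr e 5 then absdiff (ar e 5 w) (vr e 7) else ar e 5 w)"
    for D w
  have L: "(LL D)(w := if LL D w = vr e 5 then vr e 6 else LL D w) = LL (insert w D)" for D w
    using assms(2) by (auto simp: LL_def)
  have XL: "(XX D)(w := if LL D w = vr e 5 then absdiff (XX D w) (vr e 7) else XX D w) = XX (insert w D)"
    for D w
    using assms(2) by (auto simp: LL_def XX_def)
  have "ar (ev m B relabel_loop e) 4 = LL (seen m) \<and> ar (ev m B relabel_loop e) 5 = XX (seen m)"
    unfolding relabel_loop_def
  proof (rule ev_for_induct[where I = "\<lambda>k e'. ar e' 4 = LL (seen k) \<and> ar e' 5 = XX (seen k)"])
    fix k e'
    assume k: "k < m" "vr e' 4 = k" and I: "ar e' 4 = LL (seen k) \<and> ar e' 5 = XX (seen k)"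
      and un: "unchanged (HFor 4 (relabel_code 0 ;; relabel_code 1)) e e'"
    from un have fr: "vr e' 5 = vr e 5" "vr e' 6 = vr e 6" "vr e' 7 = vr e 7"
        "ar e' 0 = ar e 0" "ar e' 1 = ar e 1"
      by (simp_all add: unchanged_def merge_defs)
    define e1 where "e1 = ev m B (relabel_code 0) e'"
    have UV: "ar e 0 k = U k" "ar e (Suc 0) k = V k" using assms(1) k(1) by (auto simp: graph_envD)
    have e1: "ar e1 4 = LL (insert (U k) (seen k))" "ar e1 5 = XX (insert (U k) (seen k))"
      "vr e1 4 = k" "vr e1 5 = vr e 5" "vr e1 6 = vr e 6" "vr e1 7 = vr e 7" "ar e1 1 = ar e 1"
      using I k fr UV by (simp_all add: e1_def ev_relabel_code L XL cong: if_cong split del: if_split)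
    show "ar (ev m B (relabel_code 0 ;; relabel_code 1) e') 4 = LL (seen (Suc k)) \<and>
        ar (ev m B (relabel_code 0 ;; relabel_code 1) e') 5 = XX (seen (Suc k))"
      using e1 UV by (simp add: e1_def[symmetric] ev_relabel_code seen_Suc L XL cong: if_cong split del: if_split)
  qed (auto simp: merge_defs LL_def XX_def)
  then show ?thesis by (simp add: LL_def[abs_def] XX_def[abs_def])
qed

text \<open>Restricted to \<open>verts\<close> because the program resets and relabels only ends of
  clauses.\<close>

definition rep :: "(nat \<Rightarrow> nat) \<times> (nat \<Rightarrow> bool) \<Rightarrow> env \<Rightarrow> bool" where
  "rep p e \<longleftrightarrow> (\<forall>w\<in>verts. ar e 4 w = fst p w \<and> ar e 5 w = of_bool (snd p w))"

lemma rep_setr [simp]: "rep p (setr r x e) = rep p e"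
  by (simp add: rep_def)

lemma ev_merge_code:
  assumes "graph_env e" "rep p e" "cells_le e" "vr e 3 = j" "j < m"
  shows "rep (merge j p) (ev m B merge_code e) \<and> cells_le (ev m B merge_code e)"
proof -
  obtain l a where p: "p = (l, a)" by fastforce
  have verts: "U j \<in> verts" "V j \<in> verts" using assms(5) by (auto simp: in_verts)
  define e1 where "e1 = ev m B (HGet 10 0 3 ;; HGet 5 4 10 ;; HGet 7 5 10 ;; HGet 10 1 3 ;; HGet 6 4 10 ;;
     HGet 10 5 10 ;; absdiff_code 7 7 10 ;; HGet 10 2 3 ;; absdiff_code 7 7 10 ;;
     absdiff_code 10 5 6) e"
  have e1: "vr e1 5 = l (U j)" "vr e1 6 = l (V j)" "vr e1 7 = of_bool (\<not> sat a j)"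
    "vr e1 10 = absdiff (l (U j)) (l (V j))" "ar e1 = ar e"
    using assms(1,2,4,5) verts by (auto simp: e1_def graph_envD rep_def p sat_def)
  have ev: "ev m B merge_code e = (if l (U j) \<noteq> l (V j) then ev m B relabel_loop e1 else setr 10 0 e1)"
    using e1(4) by (simp add: merge_code_def e1_def)
  have g1: "graph_env e1" "cells_le e1" "rep p e1"
    using assms(1-3) e1(5) by (simp_all add: graph_env_def cells_le_def rep_def)
  show ?thesis
  proof (cases "l (U j) = l (V j)")
    case True
    then show ?thesis using g1 by (simp add: ev merge_def p)
  next
    case False
    let ?e = "ev m B relabel_loop e1"
    have new: "ar ?e 4 = (\<lambda>w. if w \<in> verts \<and> ar e 4 w = l (U j) then l (V j) else ar e 4 w)"
      "ar ?e 5 = (\<lambda>w. if w \<in> verts \<and> ar e 4 w = l (U j) then absdiff (ar e 5 w) (of_bool (\<not> sat a j)) else ar e 5 w)"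
      using ev_relabel_loop[OF g1(1)] False e1 by auto
    have "rep (merge j p) ?e"
      using assms(2) False by (auto simp: rep_def new merge_def p simp del: of_bool_eq)
    moreover have "cells_le ?e"
      unfolding cells_le_def
    proof (intro allI)
      fix t i
      have "ar e t i \<le> X" "l (V j) \<le> X"
        using assms(2,3) verts by (auto simp: cells_le_def rep_def p split: prod.splits) (metis fst_conv)
      moreover have "t \<noteq> 4 \<Longrightarrow> t \<noteq> 5 \<Longrightarrow> ar ?e t = ar e t"
        by (subst ev_frame) (simp_all add: merge_defs e1(5))
      ultimately show "ar ?e t i \<le> X"
        using new assms(2,3) by (cases "t = 4"; cases "t = 5") (auto simp: rep_def p simp del: of_bool_eq)
    qed
    ultimately show ?thesis using False by (simp add: ev)
  qed
qed

lemma ev_reset_code: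
  assumes "graph_env e" "cells_le e"
  shows "rep (\<lambda>w. w, \<lambda>_. False) (ev m B reset_code e) \<and> cells_le (ev m B reset_code e)"
proof -
  let ?b = "HGet 8 0 3 ;; HPut 4 8 8 ;; HPut 5 8 10 ;; HGet 8 1 3 ;; HPut 4 8 8 ;; HPut 5 8 10"
  have "(\<forall>w\<in>seen m. ar (ev m B (HFor 3 ?b) (setr 10 0 e)) 4 w = w \<and> ar (ev m B (HFor 3 ?b) (setr 10 0 e)) 5 w = 0)
      \<and> cells_le (ev m B (HFor 3 ?b) (setr 10 0 e))"
  proof (rule ev_for_induct[where I = "\<lambda>k e'. (\<forall>w\<in>seen k. ar e' 4 w = w \<and> ar e' 5 w = 0) \<and> cells_le e'"])
    fix k e'
    assume k: "k < m" "vr e' 3 = k"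
      and I: "(\<forall>w\<in>seen k. ar e' 4 w = w \<and> ar e' 5 w = 0) \<and> cells_le e'"
      and un: "unchanged (HFor 3 ?b) (setr 10 0 e) e'"
    from un have fr: "vr e' 10 = 0" "ar e' 0 = ar e 0" "ar e' (Suc 0) = ar e (Suc 0)"
      by (simp_all add: unchanged_def)
    show "(\<forall>w\<in>seen (Suc k). ar (ev m B ?b e') 4 w = w \<and> ar (ev m B ?b e') 5 w = 0) \<and> cells_le (ev m B ?b e')"
      using k I fr graph_envD[OF assms(1) k(1)] U_le V_le by (simp add: seen_Suc)
  qed (use assms(2) in simp_all)
  then show ?thesis by (simp add: reset_code_def rep_def)
qed

lemma ev_first_pass_code:
  assumes "graph_env e" "cells_le e" "rep p e" "\<forall>j<m. ar e 3 j = of_bool (F j)"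
  shows "rep (fold merge (filter F [0..<m]) p) (ev m B first_pass_code e) \<and> cells_le (ev m B first_pass_code e)"
  unfolding first_pass_code_def
proof (rule ev_for_induct[where I = "\<lambda>k e'. rep (fold merge (filter F [0..<k]) p) e' \<and> cells_le e'"])
  let ?b = "HGet 10 3 3 ;; HIf 10 merge_code (HConst 10 0)"
  fix k e'
  assume k: "k < m" "vr e' 3 = k" and I: "rep (fold merge (filter F [0..<k]) p) e' \<and> cells_le e'"
    and un: "unchanged (HFor 3 ?b) e e'"
  from un have fr: "ar e' 0 = ar e 0" "ar e' 1 = ar e 1" "ar e' 2 = ar e 2" "ar e' 3 = ar e 3"
    by (simp_all add: unchanged_def merge_defs)
  have "graph_env e'" using graph_env_cong[OF fr(1,2,3)] assms(1) by simp
  then show "rep (fold merge (filter F [0..<Suc k]) p) (ev m B ?b e') \<and> cells_le (ev m B ?b e')"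
    using k I assms(4) fr(4) ev_merge_code[of "setr 10 (ar e' 3 k) e'" "fold merge (filter F [0..<k]) p" k]
    by auto
qed (use assms in \<open>simp_all add: merge_defs\<close>)

lemma ev_second_pass_code:
  assumes "graph_env e" "cells_le e" "rep p e"
  shows "rep (fold merge [0..<m] p) (ev m B second_pass_code e) \<and> cells_le (ev m B second_pass_code e)"
  unfolding second_pass_code_def
proof (rule ev_for_induct[where I = "\<lambda>k e'. rep (fold merge [0..<k] p) e' \<and> cells_le e'"])
  fix k e'
  assume k: "k < m" "vr e' 3 = k" and I: "rep (fold merge [0..<k] p) e' \<and> cells_le e'"
    and un: "unchanged (HFor 3 merge_code) e e'"
  from un have fr: "ar e' 0 = ar e 0" "ar e' 1 = ar e 1" "ar e' 2 = ar e 2"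
    by (simp_all add: unchanged_def merge_defs)
  have "graph_env e'" using graph_env_cong[OF fr] assms(1) by simp
  then show "rep (fold merge [0..<Suc k] p) (ev m B merge_code e') \<and> cells_le (ev m B merge_code e')"
    using k I ev_merge_code[of e' "fold merge [0..<k] p" k] by simp
qed (use assms in \<open>simp_all add: merge_defs\<close>)

definition sig_env :: "bool list \<Rightarrow> env \<Rightarrow> bool" where
  "sig_env \<sigma> e \<longleftrightarrow> (\<forall>j<m. ar e 3 j = of_bool (\<sigma> ! j))"

lemma ev_signature_code:
  assumes "graph_env e" "cells_le e" "rep p e"
  shows "sig_env (sig (snd p)) (ev m B signature_code e) \<and>
    vr (ev m B signature_code e) 11 = code (sig (snd p)) \<and> cells_le (ev m B signature_code e)"
proof -
  let ?b = "HGet 8 0 3 ;; HGet 10 5 8 ;; HGet 8 1 3 ;; HGet 8 5 8 ;;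
     absdiff_code 10 10 8 ;; HGet 8 2 3 ;; absdiff_code 10 10 8 ;; HConst 8 1 ;; HSub 10 8 10 ;;
     HPut 3 3 10 ;; HAdd 11 11 11 ;; HAdd 11 11 10"
  let ?I = "\<lambda>k e'. (\<forall>j<k. ar e' 3 j = of_bool (sat (snd p) j)) \<and>
     vr e' 11 = code (map (sat (snd p)) [0..<k]) \<and> cells_le e'"
  have "?I m (ev m B (HFor 3 ?b) (setr 11 1 e))"
  proof (rule ev_for_induct[where I = ?I])
    fix k e'
    assume k: "k < m" "vr e' 3 = k" and I: "?I k e'" and un: "unchanged (HFor 3 ?b) (setr 11 1 e) e'"
    from un have fr: "ar e' 0 = ar e 0" "ar e' (Suc 0) = ar e (Suc 0)" "ar e' 2 = ar e 2" "ar e' 5 = ar e 5"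
      by (simp_all add: unchanged_def merge_defs)
    have val: "ar e 5 (U k) = of_bool (snd p (U k))" "ar e 5 (V k) = of_bool (snd p (V k))"
      using assms(3) in_verts[OF k(1)] by (auto simp: rep_def)
    have bit: "Suc 0 - of_bool ((snd p (U k) \<noteq> snd p (V k)) \<noteq> E k) = of_bool (sat (snd p) k)"
      by (simp add: sat_def)
    show "?I (Suc k) (ev m B ?b e')"
      using k I fr val graph_envD[OF assms(1) k(1)] bit
      by (simp add: code_snoc less_Suc_eq del: of_bool_eq)
  qed (use assms(2) in \<open>simp_all add: merge_defs code_def\<close>)
  then show ?thesis by (simp add: signature_code_def sig_env_def sig_def)
qed

lemma ev_completion_code:
  assumes "graph_env e" "cells_le e" "\<forall>j<m. ar e 3 j = of_bool (F j)"
  shows "sig_env (completion F) (ev m B completion_code e)"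
    and "vr (ev m B completion_code e) 11 = code (completion F)"
    and "cells_le (ev m B completion_code e)"
proof -
  define e1 where "e1 = ev m B reset_code e"
  define e2 where "e2 = ev m B first_pass_code e1"
  define e3 where "e3 = ev m B second_pass_code e2"
  have fr1: "t \<notin> {4, 5} \<Longrightarrow> ar e1 t = ar e t" for t
    unfolding e1_def by (rule ev_frame) (simp add: completion_defs)
  have fr2: "t \<notin> {4, 5} \<Longrightarrow> ar e2 t = ar e1 t" for t
    unfolding e2_def by (rule ev_frame) (simp add: completion_defs)
  have fr3: "t \<notin> {4, 5} \<Longrightarrow> ar e3 t = ar e2 t" for t
    unfolding e3_def by (rule ev_frame) (simp add: completion_defs)
  have g: "graph_env e1" "graph_env e2" "graph_env e3"
    using assms(1) fr1 fr2 fr3 by (simp_all add: graph_env_def)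
  have 1: "rep (\<lambda>w. w, \<lambda>_. False) e1 \<and> cells_le e1"
    unfolding e1_def by (rule ev_reset_code) fact+
  have 2: "rep (fold merge (filter F [0..<m]) (\<lambda>w. w, \<lambda>_. False)) e2 \<and> cells_le e2"
    unfolding e2_def by (rule ev_first_pass_code) (use 1 g fr1 assms(3) in auto)
  have 3: "rep (merge_all F) e3 \<and> cells_le e3"
    unfolding e3_def merge_all_def by (rule ev_second_pass_code) (use 2 g in auto)
  have "ev m B completion_code e = ev m B signature_code e3"
    by (simp add: completion_code_def e1_def e2_def e3_def)
  with ev_signature_code[of e3 "merge_all F"] 3 g
  show "sig_env (completion F) (ev m B completion_code e)"
    and "vr (ev m B completion_code e) 11 = code (completion F)"
    and "cells_le (ev m B completion_code e)"
    by (simp_all add: completion_def)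
qed

subsection \<open>The queue\<close>

definition queue_env :: "bool list list \<Rightarrow> env \<Rightarrow> bool" where
  "queue_env Q e \<longleftrightarrow> vr e 14 = length Q * (m + 1) \<and>
     (\<forall>q<length Q. \<forall>j<m. ar e 7 (q * (m + 1) + j) = of_bool (Q ! q ! j)) \<and>
     (\<forall>c. ar e 6 c = of_bool (c \<in> code ` set Q))"

definition push :: "bool list \<Rightarrow> bool list list \<Rightarrow> bool list list" where
  "push \<sigma> Q = (if \<sigma> \<in> set Q then Q else Q @ [\<sigma>])"

lemma push_append: "\<exists>zs. push \<sigma> Q = Q @ zs"
  by (simp add: push_def)

lemma ev_push_code:
  assumes "queue_env Q e" "cells_le e" "sig_env \<sigma> e" "vr e 11 = code \<sigma>" "length \<sigma> = m"
    "\<forall>\<tau>\<in>set Q. length \<tau> = m"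
  shows "queue_env (push \<sigma> Q) (ev m B push_code e) \<and> cells_le (ev m B push_code e)"
proof -
  \<comment> \<open>All entries have length \<open>m\<close>, so by \<open>code_inj\<close> a mark
    in the table identifies a single signature.\<close>
  have mem: "code \<sigma> \<in> code ` set Q \<longleftrightarrow> \<sigma> \<in> set Q"
    using assms(5,6) code_inj by (auto simp: image_iff) metis
  show ?thesis
  proof (cases "\<sigma> \<in> set Q")
    case True
    then show ?thesis
      using assms mem by (simp add: push_code_def push_def queue_env_def)
  next
    case False
    let ?n = "length Q * (m + 1)"
    let ?b = "HGet 10 3 3 ;; HPut 7 14 10 ;; HAdd 14 14 8"
    define e1 where "e1 = seta 6 (code \<sigma>) 1 (setr 8 1 (setr 10 0 e))"
    have e1: "vr e1 8 = 1" "vr e1 14 = ?n" "ar e1 3 = ar e 3" "ar e1 7 = ar e 7"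
      "ar e1 6 = (ar e 6)(code \<sigma> := 1)" "cells_le e1"
      using assms X_pos by (simp_all add: e1_def queue_env_def)
    define e2 where "e2 = ev m B (HFor 3 ?b) e1"
    let ?I = "\<lambda>k e'. vr e' 14 = ?n + k \<and> (\<forall>j<k. ar e' 7 (?n + j) = of_bool (\<sigma> ! j)) \<and>
       (\<forall>c<?n. ar e' 7 c = ar e 7 c) \<and> cells_le e'"
    have I: "?I m e2"
      unfolding e2_def
    proof (rule ev_for_induct[where I = ?I])
      fix k e'
      assume k: "k < m" "vr e' 3 = k" and I: "?I k e'" and un: "unchanged (HFor 3 ?b) e1 e'"
      from un have fr: "vr e' 8 = 1" "ar e' 3 k = of_bool (\<sigma> ! k)"
        using e1 assms(3) k(1) by (simp_all add: unchanged_def sig_env_def)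
      show "?I (Suc k) (ev m B ?b e')"
        using k I fr by (auto simp: less_Suc_eq simp del: of_bool_eq)
    qed (use e1 in auto)
    have fr: "vr e2 8 = 1" "ar e2 6 = (ar e 6)(code \<sigma> := 1)"
      using e1 by (simp_all add: e2_def ev_frame del: ev.simps)
    have ev: "ev m B push_code e = setr 14 (Suc (vr e2 14)) e2"
      using assms(1,4) mem False fr(1) by (simp add: push_code_def e2_def e1_def queue_env_def)
    have cell: "ar e2 7 (q * (m + 1) + j) = of_bool ((Q @ [\<sigma>]) ! q ! j)"
      if "q < Suc (length Q)" "j < m" for q j
    proof (cases "q = length Q")
      case True
      then show ?thesis using I that by simp
    next
      case False
      then have q: "q < length Q" using that by simp
      \<comment> \<open>An old entry ends before the block of the new one begins, so the writes do
        not touch it.\<close>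
      then have "q * (m + 1) + j < (q + 1) * (m + 1)" using that by simp
      also have "\<dots> \<le> ?n" using q by (intro mult_le_mono) auto
      finally show ?thesis using I q that assms(1) by (auto simp: queue_env_def nth_append)
    qed
    have "queue_env (Q @ [\<sigma>]) (setr 14 (Suc (vr e2 14)) e2)"
      unfolding queue_env_def using I cell fr(2) assms(1) by (auto simp: queue_env_def)
    then show ?thesis using I False by (simp add: ev push_def)
  qed
qed

lemma ev_flip_code:
  assumes "vr e 10 = of_bool b"
  shows "vr (ev m B (flip_code q) e) 10 = of_bool (b \<noteq> (ar e q (vr e 3) = vr e 12))"
  using assms absdiff_of_bool[of b True] by (auto simp: flip_code_def simp del: absdiff_of_bool)

lemma ev_flip_frame:
  "r \<notin> {9, 10, 17} \<Longrightarrow> vr (ev m B (flip_code q) e) r = vr e r"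
  "ar (ev m B (flip_code q) e) = ar e"
  by (auto simp: flip_code_def)

definition queue_ok :: "bool list list \<Rightarrow> env \<Rightarrow> bool" where
  "queue_ok Q e \<longleftrightarrow> queue_env Q e \<and> distinct Q \<and> set Q \<subseteq> sols \<and> graph_env e \<and> cells_le e"

lemma queue_ok_setr [simp]: "r \<noteq> 14 \<Longrightarrow> queue_ok Q (setr r x e) = queue_ok Q e"
  by (simp add: queue_ok_def queue_env_def)

lemma queue_ok_push:
  assumes "graph_env e" "queue_env Q e" "distinct Q" "set Q \<subseteq> sols" "cells_le e"
    "\<forall>j<m. ar e 3 j = of_bool (F j)"
  shows "queue_ok (push (completion F) Q) (ev m B (completion_code ;; push_code) e)"
proof -
  define e1 where "e1 = ev m B completion_code e"
  have "queue_env Q e1"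
    using assms(2) by (simp add: queue_env_def e1_def ev_frame_code)
  then have "queue_env (push (completion F) Q) (ev m B push_code e1) \<and> cells_le (ev m B push_code e1)"
    using ev_completion_code[OF assms(1,5,6)] assms(4) length_sols completion_in_sols
    by (intro ev_push_code) (auto simp: e1_def)
  moreover have "graph_env (ev m B push_code e1)"
    using assms(1) by (simp add: graph_env_def e1_def ev_frame_code)
  ultimately show ?thesis
    using assms(3,4) completion_in_sols[of F] by (auto simp: queue_ok_def push_def e1_def)
qed

lemma ev_neighbour_code:
  assumes "queue_ok Q e" "h < length Q" "vr e 13 = h * (m + 1)" "vr e 2 < m" "ar e q (vr e 2) = v"
  shows "queue_ok (push (completion (flip_bits (Q ! h) v)) Q) (ev m B (neighbour_code q) e)"
proof -
  let ?b = "HAdd 10 13 3 ;; HGet 10 7 10 ;; flip_code 0 ;; flip_code 1 ;; HPut 3 3 10"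
  define e1 where "e1 = ev m B (HFor 3 ?b) (setr 12 v e)"
  let ?I = "\<lambda>k e'. (\<forall>j<k. ar e' 3 j = of_bool (flip_bits (Q ! h) v j)) \<and> cells_le e'"
  have I: "?I m e1"
    unfolding e1_def
  proof (rule ev_for_induct[where I = ?I])
    fix k e'
    assume k: "k < m" "vr e' 3 = k" and I: "?I k e'" and un: "unchanged (HFor 3 ?b) (setr 12 v e) e'"
    from un have fr: "vr e' 12 = v" "vr e' 13 = h * (m + 1)" "ar e' 0 = ar e 0" "ar e' (Suc 0) = ar e (Suc 0)"
      "ar e' 7 (h * (m + 1) + k) = of_bool (Q ! h ! k)"
      using assms(1-3) k(1)
      by (simp_all add: unchanged_def flip_code_def absdiff_code_def queue_ok_def queue_env_def)
    define e1 where "e1 = setr 10 (of_bool (Q ! h ! k)) e'"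
    define e2 where "e2 = ev m B (flip_code 0) e1"
    define e3 where "e3 = ev m B (flip_code 1) e2"
    have UV: "ar e 0 k = U k" "ar e (Suc 0) k = V k"
      using assms(1) k(1) by (auto simp: graph_envD queue_ok_def)
    have e1: "vr e1 10 = of_bool (Q ! h ! k)" "vr e1 3 = k" "vr e1 12 = v" "ar e1 = ar e'"
      using k fr by (simp_all add: e1_def)
    have e2: "vr e2 10 = of_bool (Q ! h ! k \<noteq> (U k = v))" "vr e2 3 = k" "vr e2 12 = v" "ar e2 = ar e'"
      using ev_flip_code[OF e1(1), of 0] e1 fr UV by (simp_all add: e2_def ev_flip_frame)
    have e3: "vr e3 10 = of_bool (flip_bits (Q ! h) v k)" "vr e3 3 = k" "ar e3 = ar e'"
      using ev_flip_code[OF e2(1), of 1] e2 fr UV by (simp_all add: e3_def flip_bits_def ev_flip_frame)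
    have "ev m B ?b e' = seta 3 k (of_bool (flip_bits (Q ! h) v k)) e3"
      using e3 k fr by (simp add: e3_def e2_def e1_def)
    then show "?I (Suc k) (ev m B ?b e')"
      using e3 I by (auto simp: less_Suc_eq cells_le_def)
  qed (use assms(1) in \<open>simp_all add: flip_code_def absdiff_code_def queue_ok_def\<close>)
  have fr: "vr e1 14 = vr (setr 12 v e) 14" "\<And>t. t \<noteq> 3 \<Longrightarrow> ar e1 t = ar (setr 12 v e) t"
    unfolding e1_def by (rule ev_frame; simp add: flip_code_def absdiff_code_def)+
  have "queue_ok (push (completion (flip_bits (Q ! h) v)) Q) (ev m B (completion_code ;; push_code) e1)"
    using assms(1) I fr by (intro queue_ok_push) (auto simp: queue_ok_def graph_env_def queue_env_def)
  then show ?thesis using assms(5) by (simp add: neighbour_code_def e1_def del: ev.simps(10))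
qed

text \<open>The queue grows only at its end, so entry \<open>h\<close> stays in place while its own
  neighbours are appended.\<close>

lemma ev_neighbours_loop:
  assumes "queue_ok Q e" "h < length Q" "vr e 13 = h * (m + 1)"
  shows "\<exists>Q'. queue_ok Q' (ev m B (HFor 2 (neighbour_code 0 ;; neighbour_code 1)) e) \<and>
    (\<exists>zs. Q' = Q @ zs) \<and> (\<forall>v\<in>verts. completion (flip_bits (Q ! h) v) \<in> set Q')"
proof -
  let ?b = "neighbour_code 0 ;; neighbour_code 1"
  let ?I = "\<lambda>k e'. \<exists>Q'. queue_ok Q' e' \<and> (\<exists>zs. Q' = Q @ zs) \<and>
    (\<forall>v\<in>seen k. completion (flip_bits (Q ! h) v) \<in> set Q')"
  have "?I m (ev m B (HFor 2 ?b) e)"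
  proof (rule ev_for_induct[where I = ?I])
    fix k e'
    assume k: "k < m" "vr e' 2 = k" and I: "?I k e'" and un: "unchanged (HFor 2 ?b) e e'"
    from un have fr: "vr e' 13 = h * (m + 1)" using assms(3) by (simp add: unchanged_def code_defs)
    obtain Q1 zs where Q1: "queue_ok Q1 e'" "Q1 = Q @ zs"
      "\<forall>v\<in>seen k. completion (flip_bits (Q ! h) v) \<in> set Q1"
      using I by blast
    define e1 where "e1 = ev m B (neighbour_code 0) e'"
    have hd: "h < length Q1" "Q1 ! h = Q ! h" using assms(2) by (simp_all add: Q1(2) nth_append)
    define Q2 where "Q2 = push (completion (flip_bits (Q ! h) (U k))) Q1"
    have Q2: "queue_ok Q2 e1"
      using ev_neighbour_code[OF Q1(1) hd(1) fr, of 0 "U k"] Q1(1) k hd(2)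
      by (simp add: Q2_def e1_def graph_envD queue_ok_def)
    obtain ys where ys: "Q2 = Q @ ys"
      using push_append[of _ Q1] by (metis Q2_def Q1(2) append_assoc)
    have hd2: "h < length Q2" "Q2 ! h = Q ! h" using assms(2) by (simp_all add: ys nth_append)
    have fr1: "vr e1 13 = h * (m + 1)" "vr e1 2 = k"
      using fr k by (simp_all add: e1_def ev_frame_code)
    define Q3 where "Q3 = push (completion (flip_bits (Q ! h) (V k))) Q2"
    have Q3: "queue_ok Q3 (ev m B ?b e')"
      using ev_neighbour_code[OF Q2 hd2(1) fr1(1), of 1 "V k"] Q2 k hd2(2) fr1
      by (simp add: Q3_def e1_def graph_envD queue_ok_def)
    show "?I (Suc k) (ev m B ?b e')"
    proof (intro exI conjI ballI)
      show "queue_ok Q3 (ev m B ?b e')" by fact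
      show "Q3 = Q @ (if completion (flip_bits (Q ! h) (V k)) \<in> set Q2 then ys
          else ys @ [completion (flip_bits (Q ! h) (V k))])"
        by (simp add: Q3_def push_def ys)
      show "completion (flip_bits (Q ! h) v) \<in> set Q3" if "v \<in> seen (Suc k)" for v
        using that Q1(3) by (auto simp: seen_Suc Q3_def Q2_def push_def)
    qed
  next
    show "?I 0 e" using assms(1) by auto
  qed (simp_all add: code_defs)
  then show ?thesis by simp
qed

lemma ev_clear_code:
  "queue_ok Q (ev m B clear_code e) = queue_ok Q e"
  "vr (ev m B clear_code e) r = (if r \<in> {2..12} \<union> {16, 17} then 0 else vr e r)"
proof -
  show "queue_ok Q (ev m B clear_code e) = queue_ok Q e"
    by (simp add: clear_code_def)
  have "r \<in> {2..12} \<longleftrightarrow> r = 2 \<or> r = 3 \<or> r = 4 \<or> r = 5 \<or> r = 6 \<or> r = 7 \<or> r = 8 \<or> r = 9 \<or> r = 10 \<or> r = 11 \<or> r = 12"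
    unfolding atLeastAtMost_iff by presburger
  then show "vr (ev m B clear_code e) r = (if r \<in> {2..12} \<union> {16, 17} then 0 else vr e r)"
    by (simp add: clear_code_def)
qed

definition regs_clear :: "env \<Rightarrow> bool" where
  "regs_clear e \<longleftrightarrow> (\<forall>r. r \<notin> {13, 14, 15} \<longrightarrow> vr e r = 0)"

text \<open>As \<open>m + 1\<close> is positive, register 15 is zero exactly when no entry is left
  to process, even if there are no clauses.\<close>

definition loop_env :: "bool list list \<Rightarrow> nat \<Rightarrow> env \<Rightarrow> bool" where
  "loop_env Q h e \<longleftrightarrow> queue_ok Q e \<and> h \<le> length Q \<and> vr e 13 = h * (m + 1) \<and>
     vr e 15 = (length Q - h) * (m + 1)"

lemma ev_expand_code:
  assumes "loop_env Q h e" "h < length Q" "\<forall>r. r \<notin> {2..17} \<longrightarrow> vr e r = 0"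
  shows "\<exists>Q'. loop_env Q' (Suc h) (ev m B expand_code e) \<and> regs_clear (ev m B expand_code e) \<and>
    (\<exists>zs. Q' = Q @ zs) \<and> (\<forall>v\<in>verts. completion (flip_bits (Q ! h) v) \<in> set Q')"
proof -
  define e1 where "e1 = ev m B (HFor 2 (neighbour_code 0 ;; neighbour_code 1)) e"
  obtain Q' zs where Q': "queue_ok Q' e1" "Q' = Q @ zs"
    "\<forall>v\<in>verts. completion (flip_bits (Q ! h) v) \<in> set Q'"
    using ev_neighbours_loop[of Q e h] assms unfolding loop_env_def e1_def by blast
  have "vr e1 r = vr e r" if "r \<notin> {2, 3, 4, 5, 6, 7, 8, 9, 10, 11, 12, 14, 17}" for r
    unfolding e1_def by (rule ev_frame) (use that in \<open>simp add: code_defs\<close>)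
  then have fr1: "vr e1 13 = h * (m + 1)" "\<forall>r. r \<notin> {2..17} \<longrightarrow> vr e1 r = 0"
    using assms(1,3) by (auto simp: loop_env_def)
  define e2 where "e2 = ev m B (HFor 3 (HAdd 13 13 8)) (setr 8 1 e1)"
  have I: "vr e2 13 = h * (m + 1) + m \<and> queue_ok Q' e2"
    unfolding e2_def
  proof (rule ev_for_induct[where I = "\<lambda>k e'. vr e' 13 = h * (m + 1) + k \<and> queue_ok Q' e'"])
    fix k e' assume "vr e' 13 = h * (m + 1) + k \<and> queue_ok Q' e'"
      "unchanged (HFor 3 (HAdd 13 13 8)) (setr 8 1 e1) e'"
    then show "vr (ev m B (HAdd 13 13 8) e') 13 = h * (m + 1) + Suc k \<and> queue_ok Q' (ev m B (HAdd 13 13 8) e')"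
      by (simp add: unchanged_def)
  qed (use fr1 Q' in simp_all)
  have "vr e2 r = vr (setr 8 1 e1) r" if "r \<notin> {3, 13}" for r
    unfolding e2_def by (rule ev_frame) (use that in simp)
  then have fr2: "vr e2 8 = 1" "\<forall>r. r \<notin> {2..17} \<longrightarrow> vr e2 r = 0"
    using fr1(2) by auto
  define e3 where "e3 = setr 15 (vr e2 14 - Suc (vr e2 13)) (setr 13 (Suc (vr e2 13)) e2)"
  have ev: "ev m B expand_code e = ev m B clear_code e3"
    using fr2(1) by (simp add: expand_code_def e3_def e2_def e1_def del: ev.simps(10))
  have "vr e2 14 = length Q' * (m + 1)" using Q' I by (simp add: queue_ok_def queue_env_def)
  moreover have 13: "Suc (vr e2 13) = Suc h * (m + 1)" using I by simp
  ultimately have "vr e2 14 - Suc (vr e2 13) = (length Q' - Suc h) * (m + 1)"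
    by (simp only: diff_mult_distrib)
  moreover have "Suc h \<le> length Q'" using assms(2) Q'(2) by simp
  ultimately have "loop_env Q' (Suc h) (ev m B clear_code e3)"
    using I 13 by (simp add: loop_env_def ev_clear_code e3_def)
  moreover have "regs_clear (ev m B clear_code e3)"
    unfolding regs_clear_def
  proof (intro allI impI)
    fix r :: nat assume "r \<notin> {13, 14, 15}"
    then show "vr (ev m B clear_code e3) r = 0"
      using fr2(2) by (cases "r \<in> {2..17}") (auto simp: ev_clear_code e3_def)
  qed
  ultimately show ?thesis using Q' unfolding ev by blast
qed

lemma ev_output_code:
  assumes "loop_env Q h e" "h < length Q" "regs_clear e" "ob e = []"
  shows "ob (ev m B (output_code neg) e) = map (\<lambda>b. of_bool (b \<noteq> neg)) (Q ! h)"
    and "loop_env Q h (ev m B (output_code neg) e)"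
    and "\<forall>r. r \<notin> {2..17} \<longrightarrow> vr (ev m B (output_code neg) e) r = 0"
proof -
  let ?b = "HAdd 10 13 3 ;; HGet 10 7 10 ;; HConst 8 1 ;;
     (if neg then HSub 10 8 10 else HConst 9 0) ;; HWrite 10"
  let ?f = "\<lambda>b. of_bool (b \<noteq> neg) :: nat"
  have len: "length (Q ! h) = m"
    using assms(1,2) length_sols nth_mem[OF assms(2)] unfolding loop_env_def queue_ok_def by blast
  have "ob (ev m B (output_code neg) e) = map ?f (take m (Q ! h))"
    unfolding output_code_def
  proof (rule ev_for_induct[where I = "\<lambda>k e'. ob e' = map ?f (take k (Q ! h))"])
    fix k e'
    assume k: "k < m" "vr e' 3 = k" and I: "ob e' = map ?f (take k (Q ! h))"
      and un: "unchanged (HFor 3 ?b) e e'"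
    from un have fr: "vr e' 13 = h * (m + 1)" "ar e' 7 (h * (m + 1) + k) = of_bool (Q ! h ! k)"
      using assms(1,2) k(1) by (simp_all add: unchanged_def loop_env_def queue_ok_def queue_env_def)
    show "ob (ev m B ?b e') = map ?f (take (Suc k) (Q ! h))"
      using k I fr len by (cases neg) (auto simp: take_Suc_conv_app_nth)
  qed (use assms(4) in auto)
  then show "ob (ev m B (output_code neg) e) = map ?f (Q ! h)" by (simp add: len)
  have fr: "\<And>r. r \<notin> {3, 8, 9, 10} \<Longrightarrow> vr (ev m B (output_code neg) e) r = vr e r"
    "\<And>t. ar (ev m B (output_code neg) e) t = ar e t"
    by (rule ev_frame; auto simp: output_code_def)+
  then show "loop_env Q h (ev m B (output_code neg) e)"
    using assms(1) by (simp add: loop_env_def queue_ok_def queue_env_def graph_env_def cells_le_def)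
  show "\<forall>r. r \<notin> {2..17} \<longrightarrow> vr (ev m B (output_code neg) e) r = 0"
    using assms(3) fr(1) by (auto simp: regs_clear_def)
qed

end

section \<open>Formulas as graphs\<close>

text \<open>
  Variable \<open>x\<close> becomes the vertex \<open>x + 1\<close>, and the vertex \<open>0\<close> stands for the constant \<open>0\<close>; a clause
  with fewer than two variables is an edge to \<open>0\<close>. Negating the right-hand sides (\<open>neg\<close>) turns
  minimal signatures into maximal ones.
\<close>

definition edge_u :: "xor_cnf \<Rightarrow> nat \<Rightarrow> nat" where
  "edge_u \<phi> j = (case fst (\<phi> ! j) of [] \<Rightarrow> 0 | x # _ \<Rightarrow> Suc x)"

definition edge_v :: "xor_cnf \<Rightarrow> nat \<Rightarrow> nat" where
  "edge_v \<phi> j = (case fst (\<phi> ! j) of x # y # _ \<Rightarrow> Suc y | _ \<Rightarrow> 0)"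

definition edge_rhs :: "bool \<Rightarrow> xor_cnf \<Rightarrow> nat \<Rightarrow> bool" where
  "edge_rhs neg \<phi> j \<longleftrightarrow> (snd (\<phi> ! j) = 1) \<noteq> neg"

lemma two_xor_cases:
  assumes "two_xor_cnf \<phi>" "j < length \<phi>"
  obtains \<epsilon> where "\<phi> ! j = ([], \<epsilon>)" | x \<epsilon> where "\<phi> ! j = ([x], \<epsilon>)" | x y \<epsilon> where "\<phi> ! j = ([x, y], \<epsilon>)"
proof -
  obtain vs \<epsilon> where C: "\<phi> ! j = (vs, \<epsilon>)" by fastforce
  have "length vs \<le> 2" using assms nth_mem[OF assms(2)] C by (fastforce simp: two_xor_cnf_def)
  then consider "vs = []" | x where "vs = [x]" | x y where "vs = [x, y]"
    by (cases vs; cases "tl vs"; cases "tl (tl vs)") auto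
  then show ?thesis using C that by cases auto
qed

lemma encode_cnf_nth:
  assumes "k < length \<phi>" "i < length (encode_clause (\<phi> ! k))"
  shows "encode_cnf \<phi> ! Suc (length (concat (map encode_clause (take k \<phi>))) + i) = encode_clause (\<phi> ! k) ! i"
    and "Suc (length (concat (map encode_clause (take k \<phi>))) + i) < length (encode_cnf \<phi>)"
proof -
  have "concat (map encode_clause \<phi>) = concat (map encode_clause (take k \<phi>)) @ encode_clause (\<phi> ! k) @
      concat (map encode_clause (drop (Suc k) \<phi>))"
    using arg_cong[OF id_take_nth_drop[OF assms(1)], of "\<lambda>xs. concat (map encode_clause xs)"] by simp
  then show "encode_cnf \<phi> ! Suc (length (concat (map encode_clause (take k \<phi>))) + i) = encode_clause (\<phi> ! k) ! i"
    and "Suc (length (concat (map encode_clause (take k \<phi>))) + i) < length (encode_cnf \<phi>)"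
    using assms(2) by (simp_all add: encode_cnf_def nth_append)
qed

locale formula =
  fixes \<phi> :: xor_cnf and neg :: bool and B X :: nat
  assumes two: "two_xor_cnf \<phi>"
    and B: "length (encode_cnf \<phi>) \<le> B"
    and X: "x \<in> set (encode_cnf \<phi>) \<Longrightarrow> x < X"
begin

lemma clause_vars_less: "j < length \<phi> \<Longrightarrow> x \<in> set (fst (\<phi> ! j)) \<Longrightarrow> x < X"
  by (rule X) (force simp: encode_cnf_def encode_clause_def)

end

sublocale formula \<subseteq> bounded_graph "length \<phi>" "edge_u \<phi>" "edge_v \<phi>" "edge_rhs neg \<phi>" B X
proof
  show "1 \<le> X" using X[of "length \<phi>"] by (simp add: encode_cnf_def)
  fix j assume "j < length \<phi>"
  then show "edge_u \<phi> j \<le> X" "edge_v \<phi> j \<le> X"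
    using clause_vars_less[of j] by (auto simp: edge_u_def edge_v_def Suc_le_eq split: list.splits)
qed

context formula
begin

lemma ev_parse_clause_code:
  assumes "k < length \<phi>" "vr e 3 = k" "vr e 8 = 1"
    and p: "vr e 16 = Suc (length (concat (map encode_clause (take k \<phi>))))"
    and inp: "\<forall>i<length (encode_cnf \<phi>). inp e i = encode_cnf \<phi> ! i"
  shows "vr (ev m B (parse_clause_code neg) e) 16 = Suc (length (concat (map encode_clause (take (Suc k) \<phi>))))"
    and "ar (ev m B (parse_clause_code neg) e) =
      (ar e)(0 := (ar e 0)(k := edge_u \<phi> k), 1 := (ar e 1)(k := edge_v \<phi> k),
        2 := (ar e 2)(k := of_bool (edge_rhs neg \<phi> k)))"
proof -
  have rd: "vr e 16 + i < B" "inp e (vr e 16 + i) = encode_clause (\<phi> ! k) ! i"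
    if "i < length (encode_clause (\<phi> ! k))" for i
    using encode_cnf_nth[OF assms(1) that] inp B p by auto
  have sub: "Suc 0 - of_bool b = of_bool (\<not> b)" for b by simp
  note r = rd[of 0] rd[of "Suc 0"] rd[of "Suc (Suc 0)"] rd[of "Suc (Suc (Suc 0))"]
  have *: "vr (ev m B (parse_clause_code neg) e) 16 = vr e 16 + length (encode_clause (\<phi> ! k)) \<and>
    (\<forall>t i. ar (ev m B (parse_clause_code neg) e) t i =
      ((ar e)(0 := (ar e 0)(k := edge_u \<phi> k), 1 := (ar e 1)(k := edge_v \<phi> k),
        2 := (ar e 2)(k := of_bool (edge_rhs neg \<phi> k)))) t i)"
    using two assms(1)
    by (cases rule: two_xor_cases)
      (use r assms(2,3) in \<open>simp_all add: parse_clause_code_def parse_var_code_def encode_clause_def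
         edge_u_def edge_v_def edge_rhs_def sub\<close>)
  then show "vr (ev m B (parse_clause_code neg) e) 16 = Suc (length (concat (map encode_clause (take (Suc k) \<phi>))))"
    using p assms(1) by (simp add: take_Suc_conv_app_nth)
  show "ar (ev m B (parse_clause_code neg) e) =
      (ar e)(0 := (ar e 0)(k := edge_u \<phi> k), 1 := (ar e 1)(k := edge_v \<phi> k),
        2 := (ar e 2)(k := of_bool (edge_rhs neg \<phi> k)))"
    by (intro ext) (rule conjunct2[OF *, rule_format])
qed

lemma ev_parse_code:
  assumes inp: "\<forall>i<length (encode_cnf \<phi>). inp e i = encode_cnf \<phi> ! i" and "cells_le e"
  shows "graph_env (ev (length \<phi>) B (parse_code neg) e)" "cells_le (ev (length \<phi>) B (parse_code neg) e)"
proof -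
  let ?e = "setr 8 1 (setr 16 1 e)"
  let ?I = "\<lambda>k e'. vr e' 16 = Suc (length (concat (map encode_clause (take k \<phi>)))) \<and> cells_le e' \<and>
    (\<forall>j<k. ar e' 0 j = edge_u \<phi> j \<and> ar e' 1 j = edge_v \<phi> j \<and> ar e' 2 j = of_bool (edge_rhs neg \<phi> j))"
  have "?I (length \<phi>) (ev (length \<phi>) B (HFor 3 (parse_clause_code neg)) ?e)"
  proof (rule ev_for_induct[where I = ?I])
    fix k e'
    assume k: "k < length \<phi>" "vr e' 3 = k" and I: "?I k e'"
      and un: "unchanged (HFor 3 (parse_clause_code neg)) ?e e'"
    from un have fr: "vr e' 8 = 1" "inp e' = inp e"
      by (simp_all add: unchanged_def parse_clause_code_def parse_var_code_def)
    have p: "vr e' 16 = Suc (length (concat (map encode_clause (take k \<phi>))))" using I by simp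
    note step = ev_parse_clause_code[OF k fr(1) p, unfolded fr(2), OF inp]
    show "?I (Suc k) (ev (length \<phi>) B (parse_clause_code neg) e')"
      using I step U_le[OF k(1)] V_le[OF k(1)] by (auto simp: less_Suc_eq cells_le_def)
  qed (use assms(2) in \<open>auto simp: parse_clause_code_def parse_var_code_def\<close>)
  then show "graph_env (ev (length \<phi>) B (parse_code neg) e)" "cells_le (ev (length \<phi>) B (parse_code neg) e)"
    by (simp_all add: parse_code_def graph_env_def)
qed

text \<open>Array 3 is still zero, so the completion starts from the empty set of flagged clauses
  and yields some maximal signature. The queue pointers also rely on registers being initially
  zero.\<close>

lemma ev_init_code:
  assumes inp: "\<forall>i<length (encode_cnf \<phi>). inp e i = encode_cnf \<phi> ! i"
    and zero: "\<And>t i. ar e t i = 0" "\<And>r. vr e r = 0"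
  shows "loop_env [completion (\<lambda>_. False)] 0 (ev (length \<phi>) B (init_code neg) e)"
    and "regs_clear (ev (length \<phi>) B (init_code neg) e)"
proof -
  define e1 where "e1 = ev (length \<phi>) B (parse_code neg) e"
  have g: "graph_env e1" "cells_le e1"
    using ev_parse_code[OF inp] zero(1) by (simp_all add: e1_def cells_le_def)
  have fr: "vr e1 14 = vr e 14" "\<And>t. t \<notin> {0, 1, 2} \<Longrightarrow> ar e1 t = ar e t"
    unfolding e1_def by (rule ev_frame; simp add: code_defs)+
  define e2 where "e2 = ev (length \<phi>) B (completion_code ;; push_code) e1"
  have "queue_ok (push (completion (\<lambda>_. False)) []) e2"
    unfolding e2_def using g fr zero by (intro queue_ok_push) (auto simp: queue_env_def)
  then have Q: "queue_ok [completion (\<lambda>_. False)] e2" by (simp add: push_def)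
  have frr: "vr e2 r = 0" if "r \<notin> {3, 4, 5, 6, 7, 8, 9, 10, 11, 14, 16}" for r
  proof -
    have "vr e2 r = vr e1 r"
      unfolding e2_def by (rule ev_frame) (use that in \<open>simp add: code_defs\<close>)
    also have "\<dots> = vr e r"
      unfolding e1_def by (rule ev_frame) (use that in \<open>simp add: code_defs\<close>)
    finally show ?thesis by (simp add: zero)
  qed
  let ?e = "setr 15 (vr e2 14 - vr e2 13) e2"
  have ev: "ev (length \<phi>) B (init_code neg) e = ev (length \<phi>) B clear_code ?e"
    by (simp add: init_code_def e1_def e2_def)
  have "vr e2 14 = length \<phi> + 1" using Q by (simp add: queue_ok_def queue_env_def)
  with Q frr[of 13] show "loop_env [completion (\<lambda>_. False)] 0 (ev (length \<phi>) B (init_code neg) e)"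
    unfolding ev loop_env_def by (simp add: ev_clear_code)
  show "regs_clear (ev (length \<phi>) B (init_code neg) e)"
    unfolding ev regs_clear_def
  proof (intro allI impI)
    fix r :: nat assume "r \<notin> {13, 14, 15}"
    then show "vr (ev (length \<phi>) B clear_code ?e) r = 0"
      using frr[of r] by (cases "r \<in> {2..12} \<union> {16, 17}") (auto simp: ev_clear_code)
  qed
qed

definition out_bits :: "bool list \<Rightarrow> nat list" where
  "out_bits = map (\<lambda>b. of_bool (b \<noteq> neg))"

text \<open>Adding \<open>b 0\<close> to every value normalises the vertex of the constant to 0
  without changing any clause. The second statement covers assignments that are already
  normalised.\<close>

lemma holds_iff_sat:
  assumes "j < length \<phi>"
  shows "holds (\<lambda>x. of_bool (b (Suc x) \<noteq> b 0)) (\<phi> ! j) = (sat b j \<noteq> neg)"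
    and "(\<And>x. b (Suc x) = (a x = 1)) \<Longrightarrow> \<not> b 0 \<Longrightarrow> holds a (\<phi> ! j) = (sat b j \<noteq> neg)"
proof -
  show *: "holds a (\<phi> ! j) = (sat b j \<noteq> neg)" if "\<And>x. b (Suc x) = (a x = 1)" "\<not> b 0" for a b
    using two assms
  proof (cases rule: two_xor_cases)
    note b = that
    note defs = holds_def sat_def edge_u_def edge_v_def edge_rhs_def
    show ?thesis if "\<phi> ! j = ([], \<epsilon>)" for \<epsilon>
      using that b by (cases \<epsilon>) (simp_all add: defs)
    show ?thesis if "\<phi> ! j = ([x], \<epsilon>)" for x \<epsilon>
      using that b by (cases \<epsilon>; cases "a x") (simp_all add: defs)
    show ?thesis if "\<phi> ! j = ([x, y], \<epsilon>)" for x y \<epsilon>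
      using that b by (cases \<epsilon>; cases "a x"; cases "a y") (simp_all add: defs)
  qed
  show "holds (\<lambda>x. of_bool (b (Suc x) \<noteq> b 0)) (\<phi> ! j) = (sat b j \<noteq> neg)"
    using *[of "\<lambda>v. b v \<noteq> b 0" "\<lambda>x. of_bool (b (Suc x) \<noteq> b 0)"] by (auto simp: sat_def)
qed

lemma signatures_eq: "signatures \<phi> = range (\<lambda>b. out_bits (sig b))"
proof -
  have "signature \<phi> (\<lambda>x. of_bool (b (Suc x) \<noteq> b 0)) = out_bits (sig b)" for b
    by (rule nth_equalityI) (simp_all add: signature_def out_bits_def holds_iff_sat(1)[simplified])
  then have "out_bits (sig b) \<in> signatures \<phi>" for b
    unfolding signatures_def by (metis rangeI)
  moreover have "signature \<phi> a = out_bits (sig (case_nat False (\<lambda>x. a x = 1)))" for a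
    by (rule nth_equalityI)
      (simp_all add: signature_def out_bits_def holds_iff_sat(2)[of _ "case_nat False (\<lambda>x. a x = 1)"])
  then have "signature \<phi> a \<in> range (\<lambda>b. out_bits (sig b))" for a by blast
  ultimately show ?thesis unfolding signatures_def by blast
qed

lemma sig_eq_iff: "sig a = sig b \<longleftrightarrow> (\<forall>j<length \<phi>. sat a j = sat b j)"
  by (auto simp: list_eq_iff_nth_eq)

lemma inj_out_bits: "inj out_bits"
  unfolding out_bits_def by (rule inj_mapI) (auto simp: inj_def)

lemma out_bits_sig_eq_iff: "out_bits (sig a) = out_bits (sig b) \<longleftrightarrow> (\<forall>j<length \<phi>. sat a j = sat b j)"
  by (simp add: inj_eq[OF inj_out_bits] sig_eq_iff)

lemma bitwise_le_out_bits:
  "bitwise_le (out_bits (sig a)) (out_bits (sig b)) \<longleftrightarrow>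
    (\<forall>j<length \<phi>. if neg then sat b j \<longrightarrow> sat a j else sat a j \<longrightarrow> sat b j)"
  by (auto simp: bitwise_le_def out_bits_def list_all2_conv_all_nth)

text \<open>Complementing bits reverses the order, so with negated right-hand sides a maximal set of
  satisfied edges is output as a minimal signature.\<close>

lemma out_bits_sols: "out_bits ` sols = (if neg then minimal_signatures \<phi> else maximal_signatures \<phi>)"
proof -
  have max: "maximal a \<longleftrightarrow> (\<forall>b. (\<forall>j<length \<phi>. sat a j \<longrightarrow> sat b j) \<longrightarrow> out_bits (sig b) = out_bits (sig a))" for a
    unfolding maximal_def out_bits_sig_eq_iff by (intro all_cong1) blast
  have "out_bits ` sols = {\<sigma>. \<exists>a. \<sigma> = out_bits (sig a) \<and> maximal a}"
    unfolding sols_def by blast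
  also have "\<dots> = (if neg then minimal_signatures \<phi> else maximal_signatures \<phi>)"
  proof (cases neg)
    case True
    have le: "bitwise_le (out_bits (sig b)) (out_bits (sig a)) \<longleftrightarrow> (\<forall>j<length \<phi>. sat a j \<longrightarrow> sat b j)" for a b
      unfolding bitwise_le_out_bits if_P[OF True] ..
    show ?thesis
      unfolding max le[symmetric] minimal_signatures_def signatures_eq if_P[OF True] by blast
  next
    case False
    have le: "bitwise_le (out_bits (sig a)) (out_bits (sig b)) \<longleftrightarrow> (\<forall>j<length \<phi>. sat a j \<longrightarrow> sat b j)" for a b
      unfolding bitwise_le_out_bits if_not_P[OF False] ..
    show ?thesis
      unfolding max le[symmetric] maximal_signatures_def signatures_eq if_not_P[OF False] by blast
  qed
  finally show ?thesis .
qed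

end

section \<open>The enumeration and its delay\<close>

text \<open>Register 0 is initially 0, so the first load fetches \<open>m\<close>. Three doublings
  of \<open>m + 1\<close> give the array base \<open>8 * (m + 1)\<close>, which exceeds the input
  length of at most \<open>4 * m + 1\<close>.\<close>

definition prelude_instrs :: "instr list" where
  "prelude_instrs = [Load 3 0, Const 2 1, Add 4 3 2, Add 4 4 4, Add 4 4 4, Add 4 4 4]"

definition clear_temps :: com where
  "clear_temps = seqs [Do (Const 0 0), Do (Const 1 0)]"

definition loop_body :: "bool \<Rightarrow> com" where
  "loop_body neg = Seq (compile (output_code neg)) (Seq (Do Emit) (Seq (compile expand_code) clear_temps))"

text \<open>Machine register 20 is register 15 of the loop language, the length of the unprocessed
  part of the queue.\<close>

definition enum_prog :: "bool \<Rightarrow> com" where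
  "enum_prog neg = Seq (seqs (map Do prelude_instrs)) (Seq (compile (init_code neg)) (Seq clear_temps
     (While 20 (loop_body neg))))"

text \<open>One bound for every stretch between loop heads and outputs; the 20 covers the prelude,
  the tests and the clearing of scratch registers.\<close>

definition phase_steps :: "bool \<Rightarrow> nat \<Rightarrow> nat" where
  "phase_steps neg m = 20 + nsteps m (init_code neg) + nsteps m (output_code neg) + nsteps m expand_code"

lemma phase_steps_poly: "\<exists>p. \<forall>m. phase_steps neg m = poly p m"
proof -
  obtain p q r where "\<forall>m. nsteps m (init_code neg) = poly p m" "\<forall>m. nsteps m (output_code neg) = poly q m"
    "\<forall>m. nsteps m expand_code = poly r m"
    using nsteps_poly by metis
  then show ?thesis by (intro exI[of _ "[:20:] + p + q + r"]) (simp add: phase_steps_def)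
qed

lemma nsteps_mono: "m \<le> m' \<Longrightarrow> nsteps m c \<le> nsteps m' c"
  by (induction c) (auto intro!: add_mono mult_le_mono)

lemma phase_steps_mono: "m \<le> m' \<Longrightarrow> phase_steps neg m \<le> phase_steps neg m'"
  unfolding phase_steps_def by (intro add_mono nsteps_mono) auto

lemma well_formed_code [simp]:
  "well_formed (init_code neg)" "well_formed (output_code neg)" "well_formed expand_code"
  "silent expand_code" "silent (init_code neg)"
  by (simp_all add: code_defs)

lemma clear_temps_runs:
  assumes "rel m B e s"
  shows "\<exists>t. runs 3 clear_temps s t \<and> rel m B e t \<and> regs t 0 = 0 \<and> regs t 1 = 0"
proof -
  let ?is = "[Const 0 0, Const 1 0]"
  have "runs 3 clear_temps s (run1 Nop (fold run1 ?is s))"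
    using runs_instrs[of ?is 3 s] by (simp add: clear_temps_def)
  moreover have "rel m B e (run1 Nop (fold run1 ?is s))"
    using assms by (auto simp: rel_def run1_def)
  moreover have "regs (run1 Nop (fold run1 ?is s)) 0 = 0" "regs (run1 Nop (fold run1 ?is s)) 1 = 0"
    by (auto simp: run1_def)
  ultimately show ?thesis by blast
qed

section \<open>Input size against word length\<close>

lemma word_size_ge_1: "1 \<le> word_size x"
  by (simp add: word_size_def)

lemma less_word_size: "x < 2 ^ word_size x"
  using floorlog_leD[of 2 x "word_size x"] by (simp add: word_size_def)

lemma word_size_le_input_size: "x \<in> set ws \<Longrightarrow> word_size x \<le> input_size ws"
  unfolding input_size_def by (rule member_le_sum_list) simp_all

lemma length_le_input_size: "length ws \<le> input_size ws"
proof (induction ws)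
  case (Cons x ws)
  then show ?case using word_size_ge_1[of x] by (simp add: input_size_def)
qed simp

lemma length_concat_encode:
  "length \<phi> \<le> length (concat (map encode_clause \<phi>))"
  by (induction \<phi>) (simp_all add: encode_clause_def)

lemma length_concat_encode_le:
  "two_xor_cnf \<phi> \<Longrightarrow> length (concat (map encode_clause \<phi>)) \<le> 4 * length \<phi>"
  by (induction \<phi>) (auto simp: encode_clause_def two_xor_cnf_def)

locale enumeration =
  fixes \<phi> :: xor_cnf and neg :: bool
  assumes two_xor: "two_xor_cnf \<phi>"
begin

definition N :: nat where "N = input_size (encode_cnf \<phi>)"

definition base :: nat where "base = 8 * (length \<phi> + 1)"

lemma length_less_N: "length \<phi> < N"
  using length_le_input_size[of "encode_cnf \<phi>"] length_concat_encode[of \<phi>]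
  by (simp add: N_def encode_cnf_def)

lemma input_less: "x \<in> set (encode_cnf \<phi>) \<Longrightarrow> x < 2 ^ N"
  using less_word_size[of x] word_size_le_input_size[of x "encode_cnf \<phi>"]
  unfolding N_def by (meson less_le_trans one_le_numeral power_increasing)

end

sublocale enumeration \<subseteq> formula \<phi> neg base "2 ^ N"
proof
  show "length (encode_cnf \<phi>) \<le> base"
    using length_concat_encode_le[OF two_xor] by (simp add: encode_cnf_def base_def)
qed (use two_xor input_less in auto)

context enumeration
begin

abbreviation "mm \<equiv> length \<phi>"

abbreviation "input \<equiv> mem (initial_state (encode_cnf \<phi>))"

text \<open>A queue position is at most \<open>2 ^ mm * (mm + 1)\<close>, hence at most
  \<open>2 ^ (2 * N)\<close>. The additional 4 makes room for \<open>base\<close> and for the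
  minimal word length in \<open>runs\<close>.\<close>

definition W :: nat where "W = 2 * N + 4"

lemma W_ge: "4 \<le> W"
  by (simp add: W_def)

definition K :: nat where "K = 2 * phase_steps neg mm * (W + phase_steps neg mm)"

lemma input_less': "input i < 2 ^ N"
  using input_less by (auto simp: initial_state_def)

definition head_state :: "bool list list \<Rightarrow> nat \<Rightarrow> state \<Rightarrow> bool" where
  "head_state Q h s \<longleftrightarrow> (\<exists>e. rel mm base e s \<and> loop_env Q h e \<and> regs_clear e \<and> ob e = [] \<and>
     inp e = input \<and> regs s 0 = 0 \<and> regs s 1 = 0)"

lemma queue_length:
  assumes "loop_env Q h e"
  shows "length Q \<le> card sols"
proof -
  have "distinct Q" "set Q \<subseteq> sols" using assms by (auto simp: loop_env_def queue_ok_def)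
  then show ?thesis using card_mono[OF finite_sols] distinct_card by metis
qed

text \<open>The bound \<open>W\<close> does not depend on \<open>h\<close>: word lengths are reset
  at each loop head, however many iterations have passed.\<close>

lemma head_state_bounded:
  assumes "head_state Q h s"
  shows "bounded W s"
proof -
  obtain e where e: "rel mm base e s" "loop_env Q h e" "regs_clear e" "inp e = input"
    and temps: "regs s 0 = 0" "regs s 1 = 0"
    using assms by (auto simp: head_state_def)
  have N: "(2::nat) ^ N < 2 ^ W" "8 * (2::nat) ^ N < 2 ^ W" "(2::nat) ^ (2 * N) < 2 ^ W"
  proof -
    have "(2::nat) ^ (N + 3) < 2 ^ W" "(2::nat) ^ N < 2 ^ W" "(2::nat) ^ (2 * N) < 2 ^ W"
      by (rule power_strict_increasing; simp add: W_def)+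
    then show "(2::nat) ^ N < 2 ^ W" "8 * (2::nat) ^ N < 2 ^ W" "(2::nat) ^ (2 * N) < 2 ^ W"
      by (simp_all add: power_add)
  qed
  have mN: "mm + 1 \<le> 2 ^ N"
    using length_less_N less_exp[of N] by linarith
  have "length Q * (mm + 1) \<le> 2 ^ mm * 2 ^ N"
    using queue_length[OF e(2)] card_sols mN by (intro mult_le_mono) (auto intro: le_trans)
  also have "\<dots> \<le> 2 ^ (2 * N)"
    using length_less_N by (simp add: power_add[symmetric])
  finally have Q: "length Q * (mm + 1) < 2 ^ W" using N(3) by (rule le_less_trans)
  have "h * (mm + 1) \<le> length Q * (mm + 1)" "(length Q - h) * (mm + 1) \<le> length Q * (mm + 1)"
    using e(2) by (intro mult_le_mono; simp add: loop_env_def)+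
  then have ptr: "vr e 13 < 2 ^ W" "vr e 14 < 2 ^ W" "vr e 15 < 2 ^ W"
    using e(2) Q by (simp_all add: loop_env_def queue_ok_def queue_env_def)
  have "vr e r < 2 ^ W" for r
    using ptr e(3) by (cases "r \<in> {13, 14, 15}") (auto simp: regs_clear_def)
  then have user: "regs s (r + 5) < 2 ^ W" for r
    using e(1) by (simp add: rel_def)
  have "regs s r < 2 ^ W" for r
  proof (cases "r < 5")
    case True
    then consider "r = 0" | "r = 1" | "r = 2" | "r = 3" | "r = 4" by linarith
    then show ?thesis
      using temps e(1) N mN by cases (auto simp: rel_def base_def W_def)
  next
    case False
    then show ?thesis using user[of "r - 5"] by simp
  qed
  moreover have "mem s i < 2 ^ W" for i
  proof -
    have "cells_le e" using e(2) by (simp add: loop_env_def queue_ok_def)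
    then have "mem s i \<le> 2 ^ N"
      using mem_rel[OF e(1), of i] input_less'[of i] e(4) by (simp add: cells_le_def)
    then show ?thesis using N(1) by (rule le_less_trans)
  qed
  ultimately show ?thesis by (simp add: bounded_def)
qed

definition last_time :: "state \<Rightarrow> nat" where
  "last_time s = last (0 # map fst (outs s))"

text \<open>A gap of \<open>2 * K + 1\<close> consists of \<open>K\<close> from an output to the
  loop head, \<open>K\<close> for the test and for writing the next solution, and 1 for
  \<open>Emit\<close>.\<close>

definition enum_state :: "bool list list \<Rightarrow> nat \<Rightarrow> state \<Rightarrow> bool" where
  "enum_state Q h s \<longleftrightarrow> head_state Q h s \<and> Q \<noteq> [] \<and>
     map snd (outs s) = map out_bits (take h Q) \<and>
     (\<forall>q<h. \<forall>v\<in>verts. completion (flip_bits (Q ! q) v) \<in> set Q) \<and>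
     successively (\<lambda>t u. u \<le> t + (2 * K + 1)) (0 # map fst (outs s)) \<and>
     clock s \<le> last_time s + K"

lemma phase_time_le:
  assumes "n \<le> phase_steps neg mm" "k + n \<le> W + phase_steps neg mm"
  shows "2 * n * (k + n) \<le> K"
  unfolding K_def using assms by (intro mult_le_mono) auto

lemma enum_step:
  assumes "enum_state Q h s" "regs s 20 \<noteq> 0"
  shows "\<exists>t Q'. exec (loop_body neg) (tick (word_size (regs s 20)) s) t \<and> enum_state Q' (Suc h) t"
proof -
  let ?n1 = "nsteps mm (output_code neg)" and ?n2 = "nsteps mm expand_code"
  obtain e where e: "rel mm base e s" "loop_env Q h e" "regs_clear e" "ob e = []" "inp e = input"
    using assms(1) by (auto simp: enum_state_def head_state_def)
  have "regs s 20 = vr e 15" using e(1) unfolding rel_def by (metis numeral_plus_numeral semiring_norm(2-10))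
  then have h: "h < length Q"
    using assms(2) e(2) by (cases "h = length Q") (auto simp: loop_env_def)
  have bs: "bounded W s" using assms(1) head_state_bounded unfolding enum_state_def by blast
  let ?sa = "tick (word_size (regs s 20)) s"
  obtain sb where sb: "runs ?n1 (compile (output_code neg)) ?sa sb"
    "rel mm base (ev mm base (output_code neg) e) sb"
    using compile_runs[of "output_code neg" mm base e ?sa] e(1) by auto
  have tb: "bounded (W + (1 + ?n1)) sb" "clock sb \<le> clock s + 2 * (1 + ?n1) * (W + (1 + ?n1))"
    using runs_tick[OF sb(1)] bs W_ge by blast+
  have "2 * (1 + ?n1) * (W + (1 + ?n1)) \<le> K"
    by (rule phase_time_le) (simp_all add: phase_steps_def)
  with tb(2) have clock_sb: "clock sb \<le> clock s + K" by linarith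
  \<comment> \<open>\<open>runs\<close> describes stretches without output, so \<open>Emit\<close>
    is executed separately between two of them.\<close>
  define sc where "sc = run1 Emit sb"
  define ec where "ec = (ev mm base (output_code neg) e)\<lparr>ob := []\<rparr>"
  note out = ev_output_code[OF e(2) h e(3,4), of neg]
  have sc: "exec (Do Emit) sb sc" "outs sc = outs s @ [(clock sb + 1, out_bits (Q ! h))]"
      "clock sc = clock sb + 1" "bounded (W + (1 + ?n1)) sc" "rel mm base ec sc"
    using exec.Do[of Emit sb] sb tb(1) out(1)
    by (auto simp: sc_def run1_def runs_def rel_def out_bits_def bounded_def ec_def)
  have ec: "loop_env Q h ec" "\<forall>r. r \<notin> {2..17} \<longrightarrow> vr ec r = 0" "inp ec = input"
    using out e(5) ev_frame(3)[of mm base "output_code neg" e]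
    by (simp_all add: ec_def loop_env_def queue_ok_def queue_env_def graph_env_def cells_le_def)
  obtain sd where sd: "runs ?n2 (compile expand_code) sc sd" "rel mm base (ev mm base expand_code ec) sd"
    using compile_runs[of expand_code mm base ec sc] sc(5) by auto
  obtain t where t: "runs 3 clear_temps sd t" "rel mm base (ev mm base expand_code ec) t"
      "regs t 0 = 0" "regs t 1 = 0"
    using clear_temps_runs[OF sd(2)] by blast
  have rt: "runs (?n2 + 3) (Seq (compile expand_code) clear_temps) sc t"
    by (rule runs_Seq[OF sd(1) t(1)])
  have "clock t \<le> clock sc + 2 * (?n2 + 3) * ((W + (1 + ?n1)) + (?n2 + 3))"
    using rt sc(4) W_ge unfolding runs_def by (meson trans_le_add1)
  \<comment> \<open>Words have already grown by \<open>1 + ?n1\<close> bits before the output; the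
    steps of both halves together stay within \<open>phase_steps\<close>.\<close>
  also have "2 * (?n2 + 3) * ((W + (1 + ?n1)) + (?n2 + 3)) \<le> K"
    by (rule phase_time_le) (simp_all add: phase_steps_def)
  finally have clock_t: "clock t \<le> clock sc + K" by simp
  have outs_t: "outs t = outs s @ [(clock sb + 1, out_bits (Q ! h))]"
    using rt sc(2) by (simp add: runs_def)
  obtain Q' zs where Q': "loop_env Q' (Suc h) (ev mm base expand_code ec)"
      "regs_clear (ev mm base expand_code ec)" "Q' = Q @ zs"
      "\<forall>v\<in>verts. completion (flip_bits (Q ! h) v) \<in> set Q'"
    using ev_expand_code[OF ec(1) h ec(2)] by blast
  have "exec (loop_body neg) ?sa t"
    using sb(1) sc(1) rt unfolding loop_body_def runs_def by (blast intro: exec.Seq)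
  moreover have "enum_state Q' (Suc h) t"
    unfolding enum_state_def
  proof (intro conjI allI impI ballI)
    show "head_state Q' (Suc h) t"
      unfolding head_state_def using t Q'(1,2) ec(3)
      by (intro exI[of _ "ev mm base expand_code ec"]) (simp add: ev_frame ec_def)
    show "Q' \<noteq> []" using h Q'(3) by auto
    show "map snd (outs t) = map out_bits (take (Suc h) Q')"
      using assms(1) h by (simp add: enum_state_def outs_t Q'(3) take_Suc_conv_app_nth)
    show "completion (flip_bits (Q' ! q) v) \<in> set Q'" if "q < Suc h" "v \<in> verts" for q v
      using assms(1) that h Q'(3,4) by (cases "q = h") (auto simp: enum_state_def nth_append)
    have prev: "successively (\<lambda>t u. u \<le> t + (2 * K + 1)) (0 # map fst (outs s))" "clock s \<le> last_time s + K"
      using assms(1) by (simp_all add: enum_state_def)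
    then have "clock sb + 1 \<le> last_time s + (2 * K + 1)" using clock_sb by linarith
    then have "successively (\<lambda>t u. u \<le> t + (2 * K + 1)) ((0 # map fst (outs s)) @ [clock sb + 1])"
      unfolding successively_append_iff using prev(1) by (simp add: last_time_def)
    then show "successively (\<lambda>t u. u \<le> t + (2 * K + 1)) (0 # map fst (outs t))"
      by (simp add: outs_t)
    show "clock t \<le> last_time t + K"
      using clock_t sc(3) by (simp add: last_time_def outs_t)
  qed
  ultimately show ?thesis by blast
qed

text \<open>Every entry has been expanded, so the entries are closed under flips and
  \<open>closed_subset_sols\<close> applies. Halting costs one more test after the loop
  head.\<close>

lemma enum_done:
  assumes "enum_state Q h s" "regs s 20 = 0"
  shows "delay_at_most (2 * K + 1) (tick (word_size (regs s 20)) s)"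
    and "distinct (map snd (outs s))"
    and "set (map snd (outs s)) = out_bits ` sols"
proof -
  obtain e where e: "rel mm base e s" "loop_env Q h e"
    using assms(1) by (auto simp: enum_state_def head_state_def)
  have "regs s 20 = vr e 15" using e(1) unfolding rel_def by (metis numeral_plus_numeral semiring_norm(2-10))
  then have h: "h = length Q"
    using assms(2) e(2) by (auto simp: loop_env_def)
  have Q: "distinct Q" "set Q \<subseteq> sols" using e(2) by (auto simp: loop_env_def queue_ok_def)
  have outs: "map snd (outs s) = map out_bits Q" and ne: "Q \<noteq> []"
    using assms(1) h by (simp_all add: enum_state_def)
  have "set Q = sols"
  proof (rule closed_subset_sols[OF Q(2)])
    fix \<sigma> v assume "\<sigma> \<in> set Q" "v \<in> verts"
    then show "completion (flip_bits \<sigma> v) \<in> set Q"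
      using assms(1) h by (auto simp: enum_state_def in_set_conv_nth)
  qed (use ne in simp)
  then show "set (map snd (outs s)) = out_bits ` sols" by (simp only: outs set_map)
  show "distinct (map snd (outs s))"
    unfolding outs using Q(1) inj_out_bits by (auto simp: distinct_map intro: inj_on_subset)
  have "bounded W s" using assms(1) head_state_bounded unfolding enum_state_def by blast
  then have "clock (tick (word_size (regs s 20)) s) \<le> clock s + 2 * 1 * (W + 1)"
    by (rule tick_time) (simp add: W_def)
  also have "2 * 1 * (W + 1) \<le> K"
    by (rule phase_time_le) (simp_all add: phase_steps_def)
  also have "clock s + K \<le> last_time s + (2 * K + 1)" using assms(1) by (simp add: enum_state_def)
  finally have "successively (\<lambda>t u. u \<le> t + (2 * K + 1))
      ((0 # map fst (outs s)) @ [clock (tick (word_size (regs s 20)) s)])"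
    unfolding successively_append_iff using assms(1) by (simp add: last_time_def enum_state_def)
  then show "delay_at_most (2 * K + 1) (tick (word_size (regs s 20)) s)"
    by (simp add: delay_at_most_def)
qed

text \<open>Each iteration processes another entry of a queue of distinct solutions, so
  \<open>card sols - h\<close> decreases.\<close>

lemma enum_loop:
  assumes "enum_state Q h s"
  shows "\<exists>t. exec (While 20 (loop_body neg)) s t \<and> delay_at_most (2 * K + 1) t \<and>
    distinct (map snd (outs t)) \<and> set (map snd (outs t)) = out_bits ` sols"
  using assms
proof (induction "card sols - h" arbitrary: Q h s rule: less_induct)
  case less
  show ?case
  proof (cases "regs s 20 = 0")
    case True
    then show ?thesis
      using enum_done[OF less.prems True] exec.WhileFalse[OF True] by fastforce
  next
    case False
    obtain t Q' where t: "exec (loop_body neg) (tick (word_size (regs s 20)) s) t" "enum_state Q' (Suc h) t"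
      using enum_step[OF less.prems False] by blast
    then have "Suc h \<le> card sols"
      using queue_length by (fastforce simp: enum_state_def head_state_def loop_env_def)
    then obtain u where "exec (While 20 (loop_body neg)) t u" "delay_at_most (2 * K + 1) u"
      "distinct (map snd (outs u))" "set (map snd (outs u)) = out_bits ` sols"
      using less.hyps[OF _ t(2)] by (auto simp: diff_less_mono2)
    with exec.WhileTrue[OF False t(1)] show ?thesis by blast
  qed
qed

lemma enum_start:
  "\<exists>s. exec (Seq (seqs (map Do prelude_instrs)) (Seq (compile (init_code neg)) clear_temps))
      (initial_state (encode_cnf \<phi>)) s \<and> enum_state [completion (\<lambda>_. False)] 0 s"
proof -
  let ?s0 = "initial_state (encode_cnf \<phi>)"
  let ?s1 = "run1 Nop (fold run1 prelude_instrs ?s0)"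
  let ?n = "nsteps mm (init_code neg)"
  define e where "e = \<lparr>vr = (\<lambda>_. 0), ar = (\<lambda>_ _. 0), inp = input, ob = []\<rparr>"
  have r1: "runs 7 (seqs (map Do prelude_instrs)) ?s0 ?s1"
    by (rule runs_instrs) (simp_all add: prelude_instrs_def)
  have "input 0 = mm" by (simp add: initial_state_def encode_cnf_def)
  \<comment> \<open>All memory beyond the input is zero, so the arrays, including the exponentially
    large table of marks, need no initialisation.\<close>
  moreover have "input (base + i) = 0" for i
    using B by (simp add: initial_state_def)
  ultimately have "rel mm base e ?s1"
    by (simp add: rel_def run1_def prelude_instrs_def e_def base_def initial_state_def add.assoc)
  then obtain s2 where s2: "runs ?n (compile (init_code neg)) ?s1 s2" "rel mm base (ev mm base (init_code neg) e) s2"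
    using compile_runs[of "init_code neg" mm base e ?s1] by auto
  obtain s where s: "runs 3 clear_temps s2 s" "rel mm base (ev mm base (init_code neg) e) s"
      "regs s 0 = 0" "regs s 1 = 0"
    using clear_temps_runs[OF s2(2)] by blast
  have run: "runs (7 + (?n + 3)) (Seq (seqs (map Do prelude_instrs)) (Seq (compile (init_code neg)) clear_temps)) ?s0 s"
    by (intro runs_Seq[OF r1] runs_Seq[OF s2(1) s(1)])
  have "bounded N ?s0"
    using input_less' by (simp add: bounded_def) (simp add: initial_state_def)
  then have "bounded W ?s0" by (rule bounded_mono) (simp add: W_def)
  then have "clock s \<le> clock ?s0 + 2 * (7 + (?n + 3)) * (W + (7 + (?n + 3)))"
    using run unfolding runs_def by (blast intro: W_ge)
  also have "2 * (7 + (?n + 3)) * (W + (7 + (?n + 3))) \<le> K"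
    by (rule phase_time_le) (simp_all add: phase_steps_def)
  finally have clock: "clock s \<le> K" by (simp add: initial_state_def)
  have outs: "outs s = []" using run by (simp add: runs_def initial_state_def)
  have "\<forall>i<length (encode_cnf \<phi>). inp e i = encode_cnf \<phi> ! i"
    by (simp add: e_def initial_state_def)
  note init = ev_init_code[OF this]
  have "head_state [completion (\<lambda>_. False)] 0 s"
    unfolding head_state_def using s init
    by (intro exI[of _ "ev mm base (init_code neg) e"]) (simp add: ev_frame e_def)
  then have "enum_state [completion (\<lambda>_. False)] 0 s"
    using clock outs by (simp add: enum_state_def last_time_def)
  with run show ?thesis by (auto simp: runs_def)
qed

lemma enum_prog_correct:
  "\<exists>t. exec (enum_prog neg) (initial_state (encode_cnf \<phi>)) t \<and> delay_at_most (2 * K + 1) t \<and>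
    distinct (map snd (outs t)) \<and>
    set (map snd (outs t)) = (if neg then minimal_signatures \<phi> else maximal_signatures \<phi>)"
proof -
  obtain s where s: "exec (Seq (seqs (map Do prelude_instrs)) (Seq (compile (init_code neg)) clear_temps))
      (initial_state (encode_cnf \<phi>)) s" "enum_state [completion (\<lambda>_. False)] 0 s"
    using enum_start by blast
  obtain t where t: "exec (While 20 (loop_body neg)) s t" "delay_at_most (2 * K + 1) t"
    "distinct (map snd (outs t))" "set (map snd (outs t)) = out_bits ` sols"
    using enum_loop[OF s(2)] by blast
  from s(1) t(1) have "exec (enum_prog neg) (initial_state (encode_cnf \<phi>)) t"
    unfolding enum_prog_def by (auto elim!: exec_SeqE intro!: exec.Seq)
  with t out_bits_sols show ?thesis by auto
qed

end

lemma delay_at_most_mono: "delay_at_most d s \<Longrightarrow> d \<le> d' \<Longrightarrow> delay_at_most d' s"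
  unfolding delay_at_most_def by (erule successively_mono) auto

lemma enum_prog_poly_delay:
  "enumerates_with_poly_delay (enum_prog neg) {\<phi>. two_xor_cnf \<phi>} encode_cnf
     (\<lambda>\<phi>. if neg then minimal_signatures \<phi> else maximal_signatures \<phi>)"
proof -
  obtain q where q: "\<And>m. phase_steps neg m = poly q m" using phase_steps_poly by blast
  \<comment> \<open>This is \<open>2 * K + 1\<close> with the step count taken at \<open>N\<close>
    in place of the number of clauses; \<open>[:4, 2:]\<close> is \<open>W\<close> as a polynomial
    in \<open>N\<close>.\<close>
  define p where "p = [:4:] * q * ([:4, 2:] + q) + [:1:]"
  have "\<exists>s. exec (enum_prog neg) (initial_state (encode_cnf \<phi>)) s \<and>
      distinct (map snd (outs s)) \<and>
      set (map snd (outs s)) = (if neg then minimal_signatures \<phi> else maximal_signatures \<phi>) \<and>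
      delay_at_most (poly p (input_size (encode_cnf \<phi>))) s" if "two_xor_cnf \<phi>" for \<phi>
  proof -
    interpret enumeration \<phi> neg by unfold_locales fact
    have "phase_steps neg mm \<le> phase_steps neg N"
      by (rule phase_steps_mono) (use length_less_N in simp)
    then have "K \<le> 2 * phase_steps neg N * (W + phase_steps neg N)"
      unfolding K_def by (intro mult_le_mono) auto
    then have "2 * K + 1 \<le> poly p N"
      by (simp add: p_def q[symmetric] W_def algebra_simps)
    then show ?thesis
      using enum_prog_correct delay_at_most_mono unfolding N_def by blast
  qed
  then show ?thesis unfolding enumerates_with_poly_delay_def by blast
qed

theorem theorem3:
  shows "(\<exists>c. enumerates_with_poly_delay c {\<phi>. two_xor_cnf \<phi>} encode_cnf maximal_signatures) \<and>
         (\<exists>c. enumerates_with_poly_delay c {\<phi>. two_xor_cnf \<phi>} encode_cnf minimal_signatures)"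
  using enum_prog_poly_delay[of False] enum_prog_poly_delay[of True] by auto

end
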